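(* In the formal setting described in the context, $$I = \exp\Big(\sum_{g=0}^\infty\hbar^{2g-2}F^{(g)}\Big)\quad\text{and}\quad J=\exp\Big(\sum_{g=0}^\infty\hbar^{2g-2}G^{(g)}\Big),$$ where $$F^{(g)} = \sum_{d=1}^\infty\frac{z^d}{d!}\sum_{\alpha,\beta\vdash d}\hbar^{\ell(\alpha)+\ell(\beta)}p_\alpha(A)p_\beta(B)\vec{H}_g(\alpha,\beta),\qquad G^{(g)}=\sum_{d=1}^\infty\frac{z^{2d}}{d!}(-1)^d\sum_{\beta\vdash d}\hbar^{\ell(\beta)}p_\beta(C)\vec{H}_g(\beta).$$
   Context: Monotone walks: for $\alpha,\beta\vdash d$ and $r\ge0$, $\vec{W}^r(\alpha,\beta)$ is the number of tuples $(\rho,\tau_1,\dots,\tau_r)$ where $\rho\in\mathrm{S}(d)$ has cycle type $\alpha$, each $\tau_s=(i_s\ j_s)$ is a transposition with $i_s<j_s$, $j_1\le\dots\le j_r$, and $\rho\tau_1\cdots\tau_r$ has cycle type $\beta$; $\vec{H}^r(\alpha,\beta)$ is the number of those tuples for which $\rho,\tau_1,\dots,\tau_r$ generate a transitive subgroup of $\mathrm{S}(d)$. Set $\vec{W}^r(\beta)=\vec{W}^r((1^d),\beta)$. Monotone Hurwitz numbers of genus $g$: $\vec{H}_g(\alpha,\beta)=\vec{H}^{2g-2+\ell(\alpha)+\ell(\beta)}(\alpha,\beta)$ (zero if the exponent is negative), $\ell(\alpha)$ being the number of rows, and $\vec{H}_g(\beta)=\vec{H}_g((1^d),\beta)$.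 Formal setting: $\Lambda_A=\mathbb{C}[p_1(A),p_2(A),\dots]$, $\Lambda_B$, $\Lambda_C$ are polynomial algebras in algebraically independent indeterminates $p_k(A),p_k(B),p_k(C)$, with $p_\alpha(A)=\prod_ip_{\alpha_i}(A)$ etc.; $z,\hbar$ formal variables. $I = 1+\sum_{d\ge1}\frac{z^d}{d!}\sum_{\alpha,\beta\vdash d}p_\alpha(A)p_\beta(B)\sum_{r\ge0}\hbar^r\vec{W}^r(\alpha,\beta)\in(\Lambda_A\otimes\Lambda_B)[[z,\hbar]]$ and $J=1+\sum_{d\ge1}\frac{z^{2d}}{d!}(-1)^d\hbar^{-d}\sum_{\beta\vdash d}p_\beta(C)\sum_{r\ge0}\hbar^r\vec{W}^r(\beta)$, a formal power series in $z$ with coefficients formal Laurent series in $\hbar$ over $\Lambda_C$. *)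

theory Defs
  imports
    "HOL-Combinatorics.Orbits"
    "HOL-Algebra.Sym_Groups"
    "HOL-Algebra.Generated_Groups"
    "HOL-Library.Multiset"
    "HOL-Library.Poly_Mapping"
    "HOL-Computational_Algebra.Formal_Laurent_Series"
begin

text \<open>A partition is the multiset of its (positive) parts, so the number of rows of \<open>\<alpha>\<close> is
  \<open>size \<alpha>\<close> and \<open>(1\<^sup>d)\<close> is \<open>replicate_mset d 1\<close>. Permutations act on \<open>{1..d}\<close>.\<close>

definition partitions :: "nat \<Rightarrow> nat multiset set" where
  "partitions d = {\<alpha>. (\<forall>k\<in>#\<alpha>. 1 \<le> k) \<and> sum_mset \<alpha> = d}"

definition cycle_type :: "nat \<Rightarrow> (nat \<Rightarrow> nat) \<Rightarrow> nat multiset" where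
  "cycle_type d \<pi> = image_mset card (mset_set (orbit \<pi> ` {1..d}))"

definition monotone_walks ::
    "nat \<Rightarrow> nat \<Rightarrow> nat multiset \<Rightarrow> nat multiset \<Rightarrow> ((nat \<Rightarrow> nat) \<times> (nat \<Rightarrow> nat) list) set" where
  "monotone_walks d r \<alpha> \<beta> = {(\<rho>, \<tau>s).
     \<rho> \<in> carrier (sym_group d) \<and> cycle_type d \<rho> = \<alpha> \<and> length \<tau>s = r \<and>
     (\<exists>ijs. \<tau>s = map (\<lambda>(i, j). transpose i j) ijs \<and>
            (\<forall>(i, j)\<in>set ijs. 1 \<le> i \<and> i < j \<and> j \<le> d) \<and>
            sorted (map snd ijs)) \<and>
     cycle_type d (foldl (\<circ>) \<rho> \<tau>s) = \<beta>}"

definition walk_number :: "nat \<Rightarrow> nat \<Rightarrow> nat multiset \<Rightarrow> nat multiset \<Rightarrow> nat" where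
  "walk_number d r \<alpha> \<beta> = card (monotone_walks d r \<alpha> \<beta>)"

definition transitive_on :: "nat \<Rightarrow> (nat \<Rightarrow> nat) set \<Rightarrow> bool" where
  "transitive_on d K \<longleftrightarrow> (\<forall>x\<in>{1..d}. \<forall>y\<in>{1..d}. \<exists>\<pi>\<in>K. \<pi> x = y)"

definition hurwitz_number :: "nat \<Rightarrow> nat \<Rightarrow> nat multiset \<Rightarrow> nat multiset \<Rightarrow> nat" where
  "hurwitz_number d r \<alpha> \<beta> =
     card {(\<rho>, \<tau>s) \<in> monotone_walks d r \<alpha> \<beta>.
             transitive_on d (generate (sym_group d) (insert \<rho> (set \<tau>s)))}"

definition genus_hurwitz :: "nat \<Rightarrow> nat \<Rightarrow> nat multiset \<Rightarrow> nat multiset \<Rightarrow> nat" where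
  "genus_hurwitz d g \<alpha> \<beta> =
     (let r = 2 * int g - 2 + int (size \<alpha>) + int (size \<beta>)
      in if r < 0 then 0 else hurwitz_number d (nat r) \<alpha> \<beta>)"


text \<open>\<open>'v mpoly\<close> is the polynomial algebra over the complex numbers in indeterminates indexed
  by \<open>'v\<close>: a polynomial maps monomials (finitely supported exponent vectors) to coefficients.
  \<open>\<Lambda>\<^sub>C\<close> is \<open>nat mpoly\<close>, and \<open>\<Lambda>\<^sub>A \<otimes> \<Lambda>\<^sub>B\<close> is \<open>(nat + nat) mpoly\<close>. Since the \<open>p\<^sub>k\<close> start
  at \<open>k = 1\<close>, the indeterminate with index \<open>i\<close> is \<open>p\<^sub>i\<^sub>+\<^sub>1\<close>.

  All identities are stated in \<open>'v series\<close>: formal power series in \<open>z\<close> whose coefficients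
  are formal Laurent series in \<open>\<hbar>\<close> over \<open>'v mpoly\<close>.\<close>

type_synonym 'v mpoly = "('v \<Rightarrow>\<^sub>0 nat) \<Rightarrow>\<^sub>0 complex"
type_synonym 'v series = "'v mpoly fls fps"

definition indet :: "'v \<Rightarrow> 'v mpoly" where
  "indet v = Poly_Mapping.single (Poly_Mapping.single v 1) 1"

definition p_A :: "nat multiset \<Rightarrow> (nat + nat) mpoly" where
  "p_A \<alpha> = (\<Prod>k\<in>#\<alpha>. indet (Inl (k - 1)))"

definition p_B :: "nat multiset \<Rightarrow> (nat + nat) mpoly" where
  "p_B \<beta> = (\<Prod>k\<in>#\<beta>. indet (Inr (k - 1)))"

definition p_C :: "nat multiset \<Rightarrow> nat mpoly" where
  "p_C \<beta> = (\<Prod>k\<in>#\<beta>. indet (k - 1))"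

definition scalar :: "complex \<Rightarrow> 'v mpoly fls" where
  "scalar c = fls_const (Poly_Mapping.single 0 c)"

definition hbar_pow :: "int \<Rightarrow> 'v mpoly fls" where
  "hbar_pow n = fls_X_intpow n"


text \<open>The exponential series composed with \<open>S\<close>; as usual for composition of formal power series,
  it is meant for \<open>S\<close> without constant term in \<open>z\<close>.\<close>

definition formal_exp :: "'v series \<Rightarrow> 'v series" where
  "formal_exp S = Abs_fps (\<lambda>n. scalar (1 / fact n)) oo S"

text \<open>Infinite sums of series, taken separately in each power of \<open>z\<close>. There convergence refers
  to the library's metric on formal Laurent series, that is, to the \<open>\<hbar>\<close>-adic topology.\<close>

definition formal_summable :: "(nat \<Rightarrow> 'v series) \<Rightarrow> bool" where
  "formal_summable f \<longleftrightarrow> (\<forall>n. summable (\<lambda>g. fps_nth (f g) n))"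

definition formal_suminf :: "(nat \<Rightarrow> 'v series) \<Rightarrow> 'v series" where
  "formal_suminf f = Abs_fps (\<lambda>n. suminf (\<lambda>g. fps_nth (f g) n))"


definition I_series :: "(nat + nat) series" where
  "I_series = Abs_fps (\<lambda>d. if d = 0 then 1 else
     scalar (1 / fact d) *
     (\<Sum>\<alpha>\<in>partitions d. \<Sum>\<beta>\<in>partitions d.
        fls_const (p_A \<alpha> * p_B \<beta>) *
        fps_to_fls (Abs_fps (\<lambda>r. of_nat (walk_number d r \<alpha> \<beta>)))))"

definition J_series :: "nat series" where
  "J_series = Abs_fps (\<lambda>n. if n = 0 then 1 else if odd n then 0 else
     (let d = n div 2 in
        scalar ((-1) ^ d / fact d) * hbar_pow (- int d) *
        (\<Sum>\<beta>\<in>partitions d.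
           fls_const (p_C \<beta>) *
           fps_to_fls (Abs_fps (\<lambda>r. of_nat (walk_number d r (replicate_mset d 1) \<beta>))))))"

definition F_genus :: "nat \<Rightarrow> (nat + nat) series" where
  "F_genus g = Abs_fps (\<lambda>d. if d = 0 then 0 else
     scalar (1 / fact d) *
     (\<Sum>\<alpha>\<in>partitions d. \<Sum>\<beta>\<in>partitions d.
        hbar_pow (int (size \<alpha>) + int (size \<beta>)) * fls_const (p_A \<alpha> * p_B \<beta>) *
        of_nat (genus_hurwitz d g \<alpha> \<beta>)))"

definition G_genus :: "nat \<Rightarrow> nat series" where
  "G_genus g = Abs_fps (\<lambda>n. if n = 0 \<or> odd n then 0 else
     (let d = n div 2 in
        scalar ((-1) ^ d / fact d) *
        (\<Sum>\<beta>\<in>partitions d.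
           hbar_pow (int (size \<beta>)) * fls_const (p_C \<beta>) *
           of_nat (genus_hurwitz d g (replicate_mset d 1) \<beta>))))"

definition genus_terms :: "(nat \<Rightarrow> 'v series) \<Rightarrow> nat \<Rightarrow> 'v series" where
  "genus_terms F g = fps_const (hbar_pow (2 * int g - 2)) * F g"

end

theory Submission
  imports Defs
begin

text \<open>A monotone walk is determined by its restrictions to the components of the action of the
  group it generates: transpositions from different components have different larger entries
  \<open>j\<close>, so there is exactly one way to interleave the restricted walks monotonically. Splitting off
  the component of a fixed point gives the recurrence \<open>w\<^sub>n\<^sub>+\<^sub>1 = \<Sum>\<^sub>k (n choose k) c\<^sub>k\<^sub>+\<^sub>1 w\<^sub>n\<^sub>-\<^sub>k\<close> between all
  walks and connected walks, that is, \<open>I' = F' I\<close>, whose only solution is the exponential. By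
  Riemann--Hurwitz, connected walks from \<open>\<alpha>\<close> to \<open>\<beta>\<close> exist only for
  \<open>r = 2g - 2 + \<ell>(\<alpha>) + \<ell>(\<beta>)\<close> with \<open>g \<ge> 0\<close>, so they can be sorted by genus. The series \<open>J\<close> is
  handled in the same way, with weights that vanish unless \<open>\<alpha> = (1\<^sup>d)\<close>.\<close>

section \<open>Cycles and the Riemann--Hurwitz bound\<close>

text \<open>Components are not built from the generated group. They are read off the closed sets:
  subsets invariant under \<open>\<rho>\<close> that contain both or neither entry of every
  transposition. These are stable under symmetric difference, so they form a vector space over the
  field with two elements whose dimension is the number of components; without transpositions, that
  dimension is the number of cycles of \<open>\<rho>\<close>. Appending a transposition of i and j
  passes to the subspace of sets that do not separate i from j, so cycles and components are counted
  by the same comparison of dimensions. The group enters only where connectedness is matched with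
  transitivity. The recurrence is proved for any weight that is multiplicative in the pair of cycle
  types, so that one argument serves both series. The block split off is an arbitrary subset of the
  labels; walks are therefore studied on arbitrary finite sets, and increasing relabellings lead
  back to \<open>{1..d}\<close>. For fixed \<open>\<alpha>\<close> and \<open>\<beta>\<close>,
  distinct genera belong to distinct powers of hbar, so the sum over the genus only lists the
  coefficients of one series.\<close>

lemma orbit_eq_of_mem:
  assumes "finite S" "\<pi> permutes S" "y \<in> orbit \<pi> x"
  shows "orbit \<pi> y = orbit \<pi> x"
  using assms by (meson cyclic_on_orbit orbit_cyclic_eq3 permutation_permutes)

lemma self_in_orbit_permutes:
  assumes "finite S" "\<pi> permutes S"
  shows "x \<in> orbit \<pi> x"
  using assms by (meson permutation_permutes permutation_self_in_orbit)

lemma orbit_sym: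
  assumes "finite S" "\<pi> permutes S" "y \<in> orbit \<pi> x"
  shows "x \<in> orbit \<pi> y"
  using assms orbit_eq_of_mem self_in_orbit_permutes by metis

lemma orbit_subset_invariant:
  assumes "\<pi> ` B \<subseteq> B" "x \<in> B"
  shows "orbit \<pi> x \<subseteq> B"
proof
  fix y assume "y \<in> orbit \<pi> x"
  then show "y \<in> B" by induction (use assms in auto)
qed

section \<open>Invariant sets and the effect of a transposition on the number of cycles\<close>

definition invariant_sets :: "'a set \<Rightarrow> ('a \<Rightarrow> 'a) \<Rightarrow> 'a set set" where
  "invariant_sets S \<pi> = {B. B \<subseteq> S \<and> \<pi> ` B \<subseteq> B}"

text \<open>A forward-invariant set contains the whole cycle of each of its points, so invariant
  sets are unions of cycles and \<open>Union\<close> inverts the passage from a set to its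
  cycles.\<close>

lemma card_invariant_sets:
  assumes "finite S" "\<pi> permutes S"
  shows "card (invariant_sets S \<pi>) = 2 ^ card (orbit \<pi> ` S)"
proof -
  note self = self_in_orbit_permutes[OF assms]
  have "bij_betw (\<lambda>B. orbit \<pi> ` B) (invariant_sets S \<pi>) (Pow (orbit \<pi> ` S))"
  proof (rule bij_betw_byWitness[where f' = Union])
    show "\<forall>B\<in>invariant_sets S \<pi>. \<Union> (orbit \<pi> ` B) = B"
    proof
      fix B assume "B \<in> invariant_sets S \<pi>"
      then have "\<pi> ` B \<subseteq> B" by (simp add: invariant_sets_def)
      then have "orbit \<pi> x \<subseteq> B" if "x \<in> B" for x
        using that by (rule orbit_subset_invariant)
      then show "\<Union> (orbit \<pi> ` B) = B" using self by blast
    qed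
    have "orbit \<pi> ` (\<Union>Q) = Q" if Q: "Q \<subseteq> orbit \<pi> ` S" for Q
    proof
      show "orbit \<pi> ` \<Union>Q \<subseteq> Q"
      proof
        fix C assume "C \<in> orbit \<pi> ` \<Union>Q"
        then obtain A x where x: "x \<in> A" "A \<in> Q" "C = orbit \<pi> x" by blast
        then obtain y where "A = orbit \<pi> y" using Q by blast
        then show "C \<in> Q" using x orbit_eq_of_mem[OF assms] by simp
      qed
      show "Q \<subseteq> orbit \<pi> ` \<Union>Q"
      proof
        fix A assume A: "A \<in> Q"
        then obtain y where "A = orbit \<pi> y" using Q by blast
        then show "A \<in> orbit \<pi> ` \<Union>Q" using A self by blast
      qed
    qed
    then show "\<forall>Q\<in>Pow (orbit \<pi> ` S). orbit \<pi> ` (\<Union>Q) = Q" by blast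
    show "(\<lambda>B. orbit \<pi> ` B) ` invariant_sets S \<pi> \<subseteq> Pow (orbit \<pi> ` S)"
      by (auto simp: invariant_sets_def)
    have "\<Union>Q \<in> invariant_sets S \<pi>" if Q: "Q \<subseteq> orbit \<pi> ` S" for Q
    proof -
      have "A \<subseteq> S \<and> \<pi> ` A \<subseteq> A" if "A \<in> Q" for A
        using Q that permutes_orbit_subset[OF assms(2)] by (auto intro: orbit.step)
      then show ?thesis unfolding invariant_sets_def by blast
    qed
    then show "Union ` Pow (orbit \<pi> ` S) \<subseteq> invariant_sets S \<pi>" by blast
  qed
  then show ?thesis
    using assms(1) by (simp add: bij_betw_same_card card_Pow)
qed

text \<open>Symmetric difference with \<open>B0\<close> is an involution of the family that
  exchanges the sets separating \<open>i\<close> from \<open>j\<close> with those that do not. In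
  linear terms, a nonzero functional over the two-element field has a kernel of index two.\<close>

lemma card_unseparated_sets:
  assumes fin: "finite \<F>" and sd: "\<And>B C. B \<in> \<F> \<Longrightarrow> C \<in> \<F> \<Longrightarrow> (B - C) \<union> (C - B) \<in> \<F>"
    and B0: "B0 \<in> \<F>" "(i \<in> B0) \<noteq> (j \<in> B0)"
  shows "card \<F> = 2 * card {B \<in> \<F>. i \<in> B \<longleftrightarrow> j \<in> B}"
proof -
  let ?t = "\<lambda>B. (B - B0) \<union> (B0 - B)"
  have "bij_betw ?t {B \<in> \<F>. i \<in> B \<longleftrightarrow> j \<in> B} {B \<in> \<F>. (i \<in> B) \<noteq> (j \<in> B)}"
    by (rule bij_betw_byWitness[where f' = ?t]) (use sd B0 in auto)
  then have "card {B \<in> \<F>. i \<in> B \<longleftrightarrow> j \<in> B} = card {B \<in> \<F>. (i \<in> B) \<noteq> (j \<in> B)}"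
    by (rule bij_betw_same_card)
  moreover have "card \<F> = card ({B \<in> \<F>. i \<in> B \<longleftrightarrow> j \<in> B} \<union> {B \<in> \<F>. (i \<in> B) \<noteq> (j \<in> B)})"
    by (rule arg_cong[where f = card]) auto
  then have "card \<F> = card {B \<in> \<F>. i \<in> B \<longleftrightarrow> j \<in> B} + card {B \<in> \<F>. (i \<in> B) \<noteq> (j \<in> B)}"
    by (subst (asm) card_Un_disjoint) (use fin in auto)
  ultimately show ?thesis by simp
qed

text \<open>The new permutation sends \<open>i\<close> to \<open>\<pi> j\<close> and then follows
  the old cycle of \<open>j\<close>, which never meets \<open>i\<close>, until it arrives at
  \<open>j\<close>.\<close>

lemma orbit_transpose_joins:
  assumes "finite S" "\<pi> permutes S" "j \<notin> orbit \<pi> i"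
  shows "j \<in> orbit (\<pi> \<circ> transpose i j) i"
proof -
  let ?\<sigma> = "\<pi> \<circ> transpose i j"
  have base: "\<pi> j \<in> orbit ?\<sigma> i"
    using orbit.base[of ?\<sigma> i] by simp
  have "y \<in> orbit ?\<sigma> i" if "y \<in> orbit \<pi> j" for y
    using that
  proof induction
    case (step y)
    have "y \<noteq> i" using orbit_sym[OF assms(1,2)] step.hyps assms(3) by blast
    then have "\<pi> y = \<pi> j \<or> ?\<sigma> y = \<pi> y" by (cases "y = j") auto
    then show ?case
      using base orbit.step[OF step.IH] by metis
  qed (rule base)
  then show ?thesis using self_in_orbit_permutes[OF assms(1,2)] by blast
qed

text \<open>The new permutation maps \<open>j\<close> to \<open>\<pi> i\<close>, so the stretch of
  the old cycle from \<open>\<pi> i\<close> to the first visit at \<open>j\<close> closes up without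
  containing \<open>i\<close>.\<close>

lemma orbit_transpose_cuts:
  assumes "finite S" "\<pi> permutes S" "i \<in> S" "j \<in> S" "i \<noteq> j" "j \<in> orbit \<pi> i"
  shows "j \<notin> orbit (\<pi> \<circ> transpose i j) i"
proof -
  let ?\<sigma> = "\<pi> \<circ> transpose i j"
  have \<sigma>: "?\<sigma> permutes S"
    using assms by (intro permutes_compose permutes_swap_id)
  define n where "n = (LEAST n. 0 < n \<and> (\<pi> ^^ n) i = j)"
  have ex: "\<exists>n. 0 < n \<and> (\<pi> ^^ n) i = j"
    using assms(6) unfolding orbit_altdef by blast
  have n: "0 < n" "(\<pi> ^^ n) i = j"
    using LeastI_ex[OF ex] by (auto simp: n_def)
  have least: "(\<pi> ^^ m) i \<noteq> j" if "0 < m" "m < n" for m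
    using that not_less_Least[of m "\<lambda>n. 0 < n \<and> (\<pi> ^^ n) i = j"] by (auto simp: n_def)
  \<comment> \<open>A return to \<open>i\<close> before time \<open>n\<close> would let the
    remaining \<open>n - m\<close> steps reach \<open>j\<close> too early.\<close>
  have ne_i: "(\<pi> ^^ m) i \<noteq> i" if m: "0 < m" "m \<le> n" for m
  proof
    assume eq: "(\<pi> ^^ m) i = i"
    then have "m < n" using n assms(5) m by (cases "m = n") auto
    have "(\<pi> ^^ (n - m)) i = (\<pi> ^^ (n - m)) ((\<pi> ^^ m) i)" using eq by simp
    also have "\<dots> = (\<pi> ^^ n) i"
      using m by (metis comp_apply funpow_add le_add_diff_inverse2)
    finally show False using least[of "n - m"] n m \<open>m < n\<close> by auto
  qed
  let ?T = "(\<lambda>m. (\<pi> ^^ m) i) ` {1..n}"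
  have "?\<sigma> ((\<pi> ^^ m) i) \<in> ?T" if m: "m \<in> {1..n}" for m
  proof (cases "m = n")
    case True
    then show ?thesis using n by (auto intro!: image_eqI[where x = 1])
  next
    case False
    then have "(\<pi> ^^ m) i \<noteq> i" "(\<pi> ^^ m) i \<noteq> j" using ne_i least m by auto
    then have "?\<sigma> ((\<pi> ^^ m) i) = (\<pi> ^^ Suc m) i" by simp
    then show ?thesis using False m by (intro image_eqI[where x = "Suc m"]) auto
  qed
  then have "?\<sigma> ` ?T \<subseteq> ?T" by blast
  moreover have "j \<in> ?T" using n by (intro image_eqI[where x = n]) auto
  ultimately have "orbit ?\<sigma> j \<subseteq> ?T" by (rule orbit_subset_invariant)
  moreover have "i \<notin> ?T"
  proof
    assume "i \<in> ?T"
    then obtain m where "m \<in> {1..n}" "(\<pi> ^^ m) i = i" by (elim imageE) (rule that, assumption, rule sym)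
    then show False using ne_i[of m] by simp
  qed
  ultimately show ?thesis using orbit_sym[OF assms(1) \<sigma>] by blast
qed

text \<open>Injectivity on a finite set turns inclusion into equality; this is what makes
  differences of invariant sets invariant.\<close>

lemma invariant_sets_image:
  assumes "finite S" "\<pi> permutes S" "B \<in> invariant_sets S \<pi>"
  shows "\<pi> ` B = B"
proof (rule endo_inj_surj)
  show "finite B" "\<pi> ` B \<subseteq> B"
    using assms(1,3) by (auto simp: invariant_sets_def intro: finite_subset)
  show "inj_on \<pi> B" using assms(2) by (rule permutes_inj_on)
qed

lemma invariant_sets_symdiff:
  assumes "finite S" "\<pi> permutes S" "B \<in> invariant_sets S \<pi>" "C \<in> invariant_sets S \<pi>"
  shows "(B - C) \<union> (C - B) \<in> invariant_sets S \<pi>"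
proof -
  have "\<pi> ` ((B - C) \<union> (C - B)) = (B - C) \<union> (C - B)"
    using invariant_sets_image[OF assms(1-3)] invariant_sets_image[OF assms(1,2,4)]
    by (simp add: image_Un image_set_diff permutes_inj[OF assms(2)])
  moreover have "(B - C) \<union> (C - B) \<subseteq> S"
    using assms(3,4) by (auto simp: invariant_sets_def)
  ultimately show ?thesis by (simp add: invariant_sets_def)
qed

text \<open>If \<open>i\<close> and \<open>j\<close> share a cycle, no invariant set separates them;
  otherwise the cycle of \<open>i\<close> does. The count \<open>M\<close> serves as the link
  between two permutations, because composing with the transposition of \<open>i\<close> and
  \<open>j\<close> leaves it unchanged.\<close>

lemma card_invariant_sets_unseparated:
  assumes S: "finite S" and \<pi>: "\<pi> permutes S" and ij: "i \<in> S" "j \<in> S"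
  defines "M \<equiv> card {B \<in> invariant_sets S \<pi>. i \<in> B \<longleftrightarrow> j \<in> B}"
  shows "2 ^ card (orbit \<pi> ` S) = (if j \<in> orbit \<pi> i then M else 2 * M)"
proof (cases "j \<in> orbit \<pi> i")
  case True
  then have "i \<in> orbit \<pi> j" by (rule orbit_sym[OF S \<pi>])
  with True have "i \<in> B \<longleftrightarrow> j \<in> B" if "\<pi> ` B \<subseteq> B" for B
    using orbit_subset_invariant[OF that] by blast
  then have "{B \<in> invariant_sets S \<pi>. i \<in> B \<longleftrightarrow> j \<in> B} = invariant_sets S \<pi>"
    by (auto simp: invariant_sets_def)
  then show ?thesis using True card_invariant_sets[OF S \<pi>] by (simp add: M_def)
next
  case False
  have "orbit \<pi> i \<in> invariant_sets S \<pi>"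
    using permutes_orbit_subset[OF \<pi> ij(1)] by (auto simp: invariant_sets_def intro: orbit.step)
  moreover have "finite (invariant_sets S \<pi>)"
    using S by (auto simp: invariant_sets_def intro: finite_subset[of _ "Pow S"])
  ultimately have "card (invariant_sets S \<pi>) = 2 * M"
    unfolding M_def using False self_in_orbit_permutes[OF S \<pi>, of i] invariant_sets_symdiff[OF S \<pi>]
    by (intro card_unseparated_sets[of _ "orbit \<pi> i"]) auto
  then show ?thesis using False card_invariant_sets[OF S \<pi>] by simp
qed

text \<open>A set containing both or neither of \<open>i\<close> and \<open>j\<close> has the same
  image under \<open>\<pi>\<close> and \<open>\<sigma>\<close>, so the unseparated invariant sets
  agree. Exactly one of the two permutations has \<open>i\<close> and \<open>j\<close> on a common
  cycle, and comparing the powers of two gives the change by one.\<close>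

lemma card_orbits_transpose:
  assumes S: "finite S" and \<pi>: "\<pi> permutes S" and ij: "i \<in> S" "j \<in> S" "i \<noteq> j"
  defines "\<sigma> \<equiv> \<pi> \<circ> transpose i j"
  shows "if j \<in> orbit \<pi> i then card (orbit \<sigma> ` S) = Suc (card (orbit \<pi> ` S))
         else Suc (card (orbit \<sigma> ` S)) = card (orbit \<pi> ` S)"
proof -
  have \<sigma>: "\<sigma> permutes S"
    unfolding \<sigma>_def using assms by (intro permutes_compose permutes_swap_id)
  have im: "\<sigma> ` B = \<pi> ` B" if "i \<in> B \<longleftrightarrow> j \<in> B" for B
    unfolding \<sigma>_def image_comp[symmetric] transpose_image_eq[OF that] ..
  have eq: "{B \<in> invariant_sets S \<sigma>. i \<in> B \<longleftrightarrow> j \<in> B} = {B \<in> invariant_sets S \<pi>. i \<in> B \<longleftrightarrow> j \<in> B}"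
  proof (rule Collect_cong)
    fix B
    show "B \<in> invariant_sets S \<sigma> \<and> (i \<in> B \<longleftrightarrow> j \<in> B) \<longleftrightarrow> B \<in> invariant_sets S \<pi> \<and> (i \<in> B \<longleftrightarrow> j \<in> B)"
      using im[of B] by (cases "i \<in> B \<longleftrightarrow> j \<in> B") (simp_all add: invariant_sets_def)
  qed
  note two = card_invariant_sets_unseparated[OF S \<pi> ij(1,2)]
    card_invariant_sets_unseparated[OF S \<sigma> ij(1,2), unfolded eq]
  have inj: "a = b" if "(2::nat) ^ a = 2 ^ b" for a b :: nat using that by simp
  show ?thesis
  proof (cases "j \<in> orbit \<pi> i")
    case True
    moreover have "j \<notin> orbit \<sigma> i"
      unfolding \<sigma>_def by (rule orbit_transpose_cuts[OF S \<pi> ij True])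
    ultimately show ?thesis using two inj[of "card (orbit \<sigma> ` S)" "Suc (card (orbit \<pi> ` S))"] by simp
  next
    case False
    moreover have "j \<in> orbit \<sigma> i"
      unfolding \<sigma>_def by (rule orbit_transpose_joins[OF S \<pi> False])
    ultimately show ?thesis using two inj[of "Suc (card (orbit \<sigma> ` S))" "card (orbit \<pi> ` S)"] by simp
  qed
qed

section \<open>End points and closed sets of walks\<close>

definition walk_end :: "('a \<Rightarrow> 'a) \<Rightarrow> ('a \<times> 'a) list \<Rightarrow> 'a \<Rightarrow> 'a" where
  "walk_end \<rho> xs = foldl (\<lambda>\<pi> (i, j). \<pi> \<circ> transpose i j) \<rho> xs"

lemma walk_end_Nil [simp]: "walk_end \<rho> [] = \<rho>"
  and walk_end_snoc [simp]: "walk_end \<rho> (xs @ [(i, j)]) = walk_end \<rho> xs \<circ> transpose i j"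
  by (simp_all add: walk_end_def)

definition closed_sets :: "'a set \<Rightarrow> ('a \<Rightarrow> 'a) \<Rightarrow> ('a \<times> 'a) list \<Rightarrow> 'a set set" where
  "closed_sets S \<rho> xs = {B \<in> invariant_sets S \<rho>. \<forall>(i, j)\<in>set xs. i \<in> B \<longleftrightarrow> j \<in> B}"

lemma walk_end_permutes:
  assumes "\<rho> permutes S" "set xs \<subseteq> S \<times> S"
  shows "walk_end \<rho> xs permutes S"
  using assms(2)
proof (induction xs rule: rev_induct)
  case (snoc x xs)
  obtain i j where x: "x = (i, j)" by (cases x)
  from snoc.prems have "i \<in> S" "j \<in> S" "set xs \<subseteq> S \<times> S" by (auto simp: x)
  with snoc.IH show ?case
    unfolding x walk_end_snoc by (intro permutes_compose permutes_swap_id)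
qed (use assms in simp)

lemma walk_end_invariant:
  assumes "B \<in> closed_sets S \<rho> xs"
  shows "walk_end \<rho> xs ` B \<subseteq> B"
  using assms
proof (induction xs rule: rev_induct)
  case Nil
  then show ?case by (simp add: closed_sets_def invariant_sets_def)
next
  case (snoc x xs)
  obtain i j where x: "x = (i, j)" by (cases x)
  from snoc.prems have "B \<in> closed_sets S \<rho> xs" "i \<in> B \<longleftrightarrow> j \<in> B" by (auto simp: closed_sets_def x)
  with snoc.IH show ?case
    unfolding x walk_end_snoc image_comp[symmetric] by (simp only: transpose_image_eq)
qed

lemma finite_closed_sets: "finite S \<Longrightarrow> finite (closed_sets S \<rho> xs)"
  by (auto simp: closed_sets_def invariant_sets_def intro: finite_subset[of _ "Pow S"])

lemma closed_sets_symdiff: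
  assumes "finite S" "\<rho> permutes S" "B \<in> closed_sets S \<rho> xs" "C \<in> closed_sets S \<rho> xs"
  shows "(B - C) \<union> (C - B) \<in> closed_sets S \<rho> xs"
  using assms invariant_sets_symdiff[OF assms(1,2), of B C] by (auto simp: closed_sets_def)

text \<open>Appending a transposition either leaves the number \<open>2\<^sup>c\<close> of closed sets, where \<open>c\<close> is the
  number of components, unchanged, or halves it; in the second case it also joins two cycles of the
  end point. This gives the Riemann--Hurwitz bound \<open>\<ell>(\<alpha>) + \<ell>(\<beta>) \<le> r + 2c\<close>.\<close>

lemma riemann_hurwitz:
  assumes S: "finite S" and \<rho>: "\<rho> permutes S"
    and xs: "set xs \<subseteq> S \<times> S" "\<forall>(i, j)\<in>set xs. i \<noteq> j"
  shows "2 ^ (card (orbit \<rho> ` S) + card (orbit (walk_end \<rho> xs) ` S))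
           \<le> 2 ^ length xs * (card (closed_sets S \<rho> xs))\<^sup>2 \<and>
         even (card (orbit \<rho> ` S) + card (orbit (walk_end \<rho> xs) ` S) + length xs)"
  using xs
proof (induction xs rule: rev_induct)
  case Nil
  then show ?case
    using card_invariant_sets[OF S \<rho>] by (simp add: closed_sets_def power_add power2_eq_square)
next
  case (snoc x xs)
  obtain i j where x: "x = (i, j)" by (cases x)
  from snoc.prems have ij: "i \<in> S" "j \<in> S" "i \<noteq> j" and xs: "set xs \<subseteq> S \<times> S" "\<forall>(i, j)\<in>set xs. i \<noteq> j"
    by (auto simp: x)
  define \<sigma> where "\<sigma> = walk_end \<rho> xs"
  define N where "N = card (closed_sets S \<rho> xs)"
  define N' where "N' = card (closed_sets S \<rho> (xs @ [x]))"
  have \<sigma>: "\<sigma> permutes S" unfolding \<sigma>_def by (rule walk_end_permutes[OF \<rho> xs(1)])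
  have end': "walk_end \<rho> (xs @ [x]) = \<sigma> \<circ> transpose i j" by (simp add: x \<sigma>_def)
  note tr = card_orbits_transpose[OF S \<sigma> ij]
  have IH: "2 ^ (card (orbit \<rho> ` S) + card (orbit \<sigma> ` S)) \<le> 2 ^ length xs * N\<^sup>2"
    "even (card (orbit \<rho> ` S) + card (orbit \<sigma> ` S) + length xs)"
    using snoc.IH[OF xs] by (auto simp: \<sigma>_def N_def)
  have snoc_sets: "closed_sets S \<rho> (xs @ [x]) = {B \<in> closed_sets S \<rho> xs. i \<in> B \<longleftrightarrow> j \<in> B}"
    by (auto simp: closed_sets_def x)
  define l where "l = card (orbit \<rho> ` S)"
  define m where "m = card (orbit \<sigma> ` S)"
  define m' where "m' = card (orbit (\<sigma> \<circ> transpose i j) ` S)"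
  have "2 ^ (l + m') \<le> 2 ^ length (xs @ [x]) * N'\<^sup>2"
  proof (cases "\<exists>B0\<in>closed_sets S \<rho> xs. (i \<in> B0) \<noteq> (j \<in> B0)")
    case True
    then obtain B0 where B0: "B0 \<in> closed_sets S \<rho> xs" "(i \<in> B0) \<noteq> (j \<in> B0)" by blast
    have "N = 2 * N'"
      unfolding N_def N'_def snoc_sets
      by (rule card_unseparated_sets[OF finite_closed_sets[OF S] closed_sets_symdiff[OF S \<rho>] B0])
    \<comment> \<open>A closed set is also invariant under the current end point, so its separating
      \<open>i\<close> from \<open>j\<close> places them on different cycles.\<close>
    have "\<sigma> ` B0 \<subseteq> B0" unfolding \<sigma>_def by (rule walk_end_invariant[OF B0(1)])
    then have "j \<notin> orbit \<sigma> i"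
      using B0(2) orbit_subset_invariant[of \<sigma> B0] orbit_sym[OF S \<sigma>] by blast
    then have m: "m = Suc m'" using tr by (simp add: m_def m'_def)
    show ?thesis using IH(1) \<open>N = 2 * N'\<close>
      by (simp add: l_def[symmetric] m_def[symmetric] m power_mult_distrib mult_ac)
  next
    case False
    then have "closed_sets S \<rho> (xs @ [x]) = closed_sets S \<rho> xs" unfolding snoc_sets by blast
    then have "N' = N" by (simp add: N_def N'_def)
    \<comment> \<open>The number of cycles may rise here, but only by one, which the factor two
      gained from the longer walk pays for.\<close>
    moreover have "m' \<le> Suc m" using tr by (auto simp: m_def m'_def split: if_splits)
    then have "(2::nat) ^ (l + m') \<le> 2 ^ Suc (l + m)" by (intro power_increasing) auto
    ultimately show ?thesis using IH(1) by (simp add: l_def[symmetric] m_def[symmetric])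
  qed
  moreover have "even (l + m' + length (xs @ [x]))"
  proof -
    have "m' = Suc m \<or> m = Suc m'" using tr by (auto simp: m_def m'_def split: if_splits)
    moreover have "even (l + m + length xs)" using IH(2) by (simp add: l_def m_def)
    ultimately show ?thesis by auto
  qed
  ultimately show ?case unfolding end' l_def m'_def N'_def by blast
qed

section \<open>Decomposition of walks into components\<close>

definition cyc_type :: "'a set \<Rightarrow> ('a \<Rightarrow> 'a) \<Rightarrow> nat multiset" where
  "cyc_type S \<pi> = image_mset card (mset_set (orbit \<pi> ` S))"

type_synonym 'a walk = "('a \<Rightarrow> 'a) \<times> ('a \<times> 'a) list"

definition walks :: "'a::linorder set \<Rightarrow> nat \<Rightarrow> 'a walk set" where
  "walks S r = {(\<rho>, xs). \<rho> permutes S \<and> length xs = r \<and>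
     (\<forall>(i, j)\<in>set xs. i \<in> S \<and> j \<in> S \<and> i < j) \<and> sorted (map snd xs)}"

text \<open>Closed sets are the unions of components, so \<open>S\<close> is a single component exactly if only
  \<open>{}\<close> and \<open>S\<close> are closed.\<close>

definition connected_walks :: "'a::linorder set \<Rightarrow> nat \<Rightarrow> 'a walk set" where
  "connected_walks S r = {(\<rho>, xs) \<in> walks S r. closed_sets S \<rho> xs \<subseteq> {{}, S}}"

text \<open>Testing the larger entry suffices: for a closed set both entries lie on the same side.
  \<open>perm_restrict\<close> is the identity outside \<open>B\<close>, as \<open>permutes\<close>
  demands.\<close>

definition restrict_walk :: "'a set \<Rightarrow> 'a walk \<Rightarrow> 'a walk" where
  "restrict_walk B w = (perm_restrict (fst w) B, filter (\<lambda>p. snd p \<in> B) (snd w))"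

text \<open>Meant for walks on disjoint sets: the permutations then commute, and each larger entry
  occurs in one list only. The stability of \<open>sort_key\<close> keeps the order of the
  transpositions that share it.\<close>

definition glue_walks :: "'a::linorder walk \<Rightarrow> 'a walk \<Rightarrow> 'a walk" where
  "glue_walks u v = (fst u \<circ> fst v, sort_key snd (snd u @ snd v))"

definition walk_weight :: "(nat multiset \<Rightarrow> nat multiset \<Rightarrow> 'r) \<Rightarrow> 'a set \<Rightarrow> 'a walk \<Rightarrow> 'r" where
  "walk_weight g S w = g (cyc_type S (fst w)) (cyc_type S (walk_end (fst w) (snd w)))"

lemma finite_walks:
  assumes "finite S"
  shows "finite (walks S r)"
proof (rule finite_subset)
  show "walks S r \<subseteq> {\<rho>. \<rho> permutes S} \<times> {xs. set xs \<subseteq> S \<times> S \<and> length xs = r}"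
    by (auto simp: walks_def)
  show "finite \<dots>"
    using assms by (simp add: finite_permutations finite_lists_length_eq)
qed

lemma perm_restrict_permutes:
  assumes "finite B" "\<rho> permutes S" "\<rho> ` B \<subseteq> B"
  shows "perm_restrict \<rho> B permutes B"
proof (rule bij_imp_permutes)
  have inj: "inj_on \<rho> B" using assms(2) by (rule permutes_inj_on)
  then have "bij_betw \<rho> B B"
    using endo_inj_surj[OF assms(1,3)] by (simp add: bij_betw_def)
  then show "bij_betw (perm_restrict \<rho> B) B B"
    by (rule bij_betw_cong[THEN iffD1, rotated]) (simp add: perm_restrict_def)
qed (simp add: perm_restrict_def)

lemma orbit_perm_restrict:
  assumes "finite S" "\<pi> permutes S" "\<pi> ` B \<subseteq> B" "x \<in> B"
  shows "orbit (perm_restrict \<pi> B) x = orbit \<pi> x"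
proof (rule orbit_cong)
  show "x \<in> orbit \<pi> x" using assms(1,2) by (rule self_in_orbit_permutes)
  fix s assume "s \<in> orbit \<pi> x"
  then have "s \<in> B" using orbit_subset_invariant[OF assms(3,4)] by blast
  then show "perm_restrict \<pi> B s = \<pi> s" by (simp add: perm_restrict_def)
qed

lemma cyc_type_split:
  assumes S: "finite S" and \<pi>: "\<pi> permutes S" and B: "B \<subseteq> S" "\<pi> ` B \<subseteq> B" "\<pi> ` (S - B) \<subseteq> S - B"
  shows "cyc_type S \<pi> = cyc_type B (perm_restrict \<pi> B) + cyc_type (S - B) (perm_restrict \<pi> (S - B))"
proof -
  have "orbit \<pi> ` S = orbit \<pi> ` B \<union> orbit \<pi> ` (S - B)" using B(1) by blast
  moreover have "orbit \<pi> ` B \<inter> orbit \<pi> ` (S - B) = {}"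
  proof -
    have "orbit \<pi> x \<noteq> orbit \<pi> y" if "x \<in> B" "y \<in> S - B" for x y
      using orbit_subset_invariant[OF B(2) that(1)] orbit_subset_invariant[OF B(3) that(2)]
        self_in_orbit_permutes[OF S \<pi>, of x] by blast
    then show ?thesis by blast
  qed
  moreover have "finite B" using B(1) S by (rule finite_subset)
  ultimately have "mset_set (orbit \<pi> ` S) = mset_set (orbit \<pi> ` B) + mset_set (orbit \<pi> ` (S - B))"
    using S by (simp add: mset_set_Union)
  moreover have "orbit (perm_restrict \<pi> B) ` B = orbit \<pi> ` B"
    by (intro image_cong refl orbit_perm_restrict[OF S \<pi> B(2)])
  moreover have "orbit (perm_restrict \<pi> (S - B)) ` (S - B) = orbit \<pi> ` (S - B)"
    by (intro image_cong refl orbit_perm_restrict[OF S \<pi> B(3)])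
  ultimately show ?thesis by (simp add: cyc_type_def)
qed

text \<open>A transposition with both entries outside \<open>B\<close> fixes \<open>B\<close>
  pointwise, so dropping it does not affect the restricted end point; one with both entries inside
  fixes the complement.\<close>

lemma walk_end_restrict:
  assumes "\<forall>(i, j)\<in>set xs. i \<in> B \<longleftrightarrow> j \<in> B"
  shows "walk_end (perm_restrict \<rho> B) (filter (\<lambda>p. snd p \<in> B) xs) = perm_restrict (walk_end \<rho> xs) B"
  using assms
proof (induction xs rule: rev_induct)
  case (snoc x xs)
  obtain i j where x: "x = (i, j)" by (cases x)
  from snoc.prems have ij: "i \<in> B \<longleftrightarrow> j \<in> B" by (simp add: x)
  have IH: "walk_end (perm_restrict \<rho> B) (filter (\<lambda>p. snd p \<in> B) xs) = perm_restrict (walk_end \<rho> xs) B"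
    using snoc by simp
  have "transpose i j y \<in> B \<longleftrightarrow> y \<in> B" for y using ij by (auto simp: transpose_def)
  moreover have "transpose i j y = y" if "y \<notin> B" "j \<in> B" for y
    using that ij by (auto simp: transpose_def)
  moreover have "transpose i j y = y" if "y \<in> B" "j \<notin> B" for y
    using that ij by (auto simp: transpose_def)
  ultimately have eq: "perm_restrict (walk_end \<rho> xs \<circ> transpose i j) B =
      (if j \<in> B then perm_restrict (walk_end \<rho> xs) B \<circ> transpose i j else perm_restrict (walk_end \<rho> xs) B)"
    by (auto simp: perm_restrict_def fun_eq_iff)
  have "filter (\<lambda>p. snd p \<in> B) (xs @ [x]) =
      (if j \<in> B then filter (\<lambda>p. snd p \<in> B) xs @ [(i, j)] else filter (\<lambda>p. snd p \<in> B) xs)"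
    by (simp add: x)
  then show ?case
    using eq IH unfolding x by (cases "j \<in> B") (simp_all only: walk_end_snoc if_True if_False)
qed simp

text \<open>Closed sets are equal to their images under \<open>\<rho>\<close>, not merely invariant,
  and injectivity carries this over to differences. The main use is the complement
  \<open>S - B\<close>.\<close>

lemma closed_sets_Diff:
  assumes "finite S" "\<rho> permutes S" "set xs \<subseteq> S \<times> S" "B \<in> closed_sets S \<rho> xs" "C \<in> closed_sets S \<rho> xs"
  shows "B - C \<in> closed_sets S \<rho> xs"
proof -
  have eq: "\<rho> ` D = D" if "D \<in> closed_sets S \<rho> xs" for D
    using that by (intro invariant_sets_image[OF assms(1,2)]) (simp add: closed_sets_def)
  have "\<rho> ` (B - C) = B - C"
    using eq[OF assms(4)] eq[OF assms(5)] by (simp add: image_set_diff permutes_inj[OF assms(2)])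
  then show ?thesis
    using assms(3-5) by (auto simp: closed_sets_def invariant_sets_def)
qed

lemma closed_sets_total:
  assumes "\<rho> permutes S" "set xs \<subseteq> S \<times> S"
  shows "S \<in> closed_sets S \<rho> xs"
  using assms by (auto simp: closed_sets_def invariant_sets_def permutes_in_image)

text \<open>Translates connectedness of the restricted walk into minimality of \<open>B\<close>
  among the nonempty closed sets of the full walk.\<close>

lemma closed_sets_restrict:
  assumes "B \<in> closed_sets S \<rho> xs"
  shows "closed_sets B (perm_restrict \<rho> B) (filter (\<lambda>p. snd p \<in> B) xs) = {D \<in> closed_sets S \<rho> xs. D \<subseteq> B}"
proof -
  have B: "B \<subseteq> S" "\<forall>(i, j)\<in>set xs. i \<in> B \<longleftrightarrow> j \<in> B"
    using assms by (auto simp: closed_sets_def invariant_sets_def)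
  have "D \<in> closed_sets B (perm_restrict \<rho> B) (filter (\<lambda>p. snd p \<in> B) xs) \<longleftrightarrow>
      D \<in> closed_sets S \<rho> xs" if D: "D \<subseteq> B" for D
  proof -
    have "perm_restrict \<rho> B ` D = \<rho> ` D"
      using D by (intro image_cong refl) (auto simp: perm_restrict_def)
    moreover have "(\<forall>(i, j)\<in>set (filter (\<lambda>p. snd p \<in> B) xs). i \<in> D \<longleftrightarrow> j \<in> D) \<longleftrightarrow>
        (\<forall>(i, j)\<in>set xs. i \<in> D \<longleftrightarrow> j \<in> D)"
      using B(2) D by auto
    ultimately show ?thesis
      using B(1) D unfolding closed_sets_def invariant_sets_def by auto
  qed
  moreover have "D \<subseteq> B" if "D \<in> closed_sets B (perm_restrict \<rho> B) (filter (\<lambda>p. snd p \<in> B) xs)" for D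
    using that by (simp add: closed_sets_def invariant_sets_def)
  ultimately show ?thesis by blast
qed

text \<open>For a walk this is the orbit of \<open>s\<close> under the group generated by the
  permutation and the transpositions, described without that group as the least closed set around
  \<open>s\<close>.\<close>

definition component :: "'a \<Rightarrow> 'a set \<Rightarrow> 'a walk \<Rightarrow> 'a set" where
  "component s S w = \<Inter> {B \<in> closed_sets S (fst w) (snd w). s \<in> B}"

lemma walksD:
  assumes "(\<rho>, xs) \<in> walks S r"
  shows "\<rho> permutes S" "set xs \<subseteq> S \<times> S" "length xs = r" "sorted (map snd xs)"
    "\<forall>(i, j)\<in>set xs. i \<in> S \<and> j \<in> S \<and> i < j"
  using assms by (auto simp: walks_def)

lemma component_closed:
  assumes "(\<rho>, xs) \<in> walks S r" "s \<in> S"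
  shows "component s S (\<rho>, xs) \<in> closed_sets S \<rho> xs"
proof -
  have "S \<in> closed_sets S \<rho> xs" using closed_sets_total walksD[OF assms(1)] by blast
  then have "component s S (\<rho>, xs) \<subseteq> S" using assms(2) by (auto simp: component_def)
  moreover have "\<rho> x \<in> B" if "x \<in> component s S (\<rho>, xs)" "B \<in> closed_sets S \<rho> xs" "s \<in> B" for x B
    using that by (auto simp: component_def closed_sets_def invariant_sets_def)
  then have "\<rho> ` component s S (\<rho>, xs) \<subseteq> component s S (\<rho>, xs)"
    by (auto simp: component_def)
  moreover have "i \<in> component s S (\<rho>, xs) \<longleftrightarrow> j \<in> component s S (\<rho>, xs)" if "(i, j) \<in> set xs" for i j
  proof -
    have "i \<in> B \<longleftrightarrow> j \<in> B" if "B \<in> closed_sets S \<rho> xs" for B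
      using that \<open>(i, j) \<in> set xs\<close> by (auto simp: closed_sets_def)
    then show ?thesis by (simp add: component_def)
  qed
  ultimately show ?thesis unfolding closed_sets_def invariant_sets_def by blast
qed

text \<open>If a closed set \<open>D\<close> inside the component misses \<open>s\<close>, then
  removing it leaves a closed set around \<open>s\<close>, so \<open>D\<close> is empty by
  leastness. Conversely, the component is a nonempty closed subset of any closed \<open>B\<close>
  around \<open>s\<close>, and equals \<open>B\<close> if \<open>B\<close> has no smaller
  one.\<close>

lemma component_eq_iff:
  assumes w: "(\<rho>, xs) \<in> walks S r" and s: "s \<in> B" and S: "finite S" and B: "B \<subseteq> S"
  shows "component s S (\<rho>, xs) = B \<longleftrightarrow>
    B \<in> closed_sets S \<rho> xs \<and>
    closed_sets B (perm_restrict \<rho> B) (filter (\<lambda>p. snd p \<in> B) xs) \<subseteq> {{}, B}"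
proof -
  let ?C = "component s S (\<rho>, xs)"
  have closed: "?C \<in> closed_sets S \<rho> xs" using component_closed[OF w] s B by blast
  have least: "?C \<subseteq> D" if "D \<in> closed_sets S \<rho> xs" "s \<in> D" for D
    using that by (auto simp: component_def)
  have sC: "s \<in> ?C" by (simp add: component_def)
  show ?thesis
  proof
    assume C: "?C = B"
    have "D = {} \<or> D = B" if D: "D \<in> closed_sets S \<rho> xs" "D \<subseteq> B" for D
    proof (cases "s \<in> D")
      case True
      then show ?thesis using least[OF D(1)] C D(2) by blast
    next
      case False
      have "B - D \<in> closed_sets S \<rho> xs"
        using closed_sets_Diff[OF S walksD(1,2)[OF w]] closed C D(1) by blast
      then have "?C \<subseteq> B - D" using False s by (intro least) auto
      then show ?thesis using C D(2) by blast
    qed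
    then show "B \<in> closed_sets S \<rho> xs \<and>
      closed_sets B (perm_restrict \<rho> B) (filter (\<lambda>p. snd p \<in> B) xs) \<subseteq> {{}, B}"
      using closed C by (auto simp: closed_sets_restrict)
  next
    assume a: "B \<in> closed_sets S \<rho> xs \<and>
      closed_sets B (perm_restrict \<rho> B) (filter (\<lambda>p. snd p \<in> B) xs) \<subseteq> {{}, B}"
    then have "?C \<subseteq> B" using least s by blast
    then have "?C \<in> {{}, B}" using a closed closed_sets_restrict[of B S \<rho> xs] by blast
    then show "?C = B" using sC by blast
  qed
qed

section \<open>Cutting a walk along a closed set and gluing the pieces\<close>

lemma restrict_walk_in_walks:
  assumes w: "(\<rho>, xs) \<in> walks S r" and B: "B \<in> closed_sets S \<rho> xs" and S: "finite S"
  shows "restrict_walk B (\<rho>, xs) \<in> walks B (length (filter (\<lambda>p. snd p \<in> B) xs))"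
proof -
  have "B \<subseteq> S" "\<rho> ` B \<subseteq> B" using B by (auto simp: closed_sets_def invariant_sets_def)
  then have "perm_restrict \<rho> B permutes B"
    using walksD(1)[OF w] finite_subset[OF _ S] by (intro perm_restrict_permutes)
  moreover have "sorted (map snd (filter (\<lambda>p. snd p \<in> B) xs))"
    using walksD(4)[OF w] by (rule sorted_filter)
  ultimately show ?thesis
    using walksD(5)[OF w] B by (auto simp: walks_def restrict_walk_def closed_sets_def)
qed

text \<open>A stable sort is determined by the multiset, the sortedness and the sublist for each
  key. For a fixed larger entry only one of the two filtered lists contributes, and it does so with
  the same sublist as \<open>xs\<close>; hence sorting restores the original interleaving.\<close>

lemma glue_restrict:
  assumes w: "(\<rho>, xs) \<in> walks S r" and B: "B \<in> closed_sets S \<rho> xs" and S: "finite S"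
  shows "glue_walks (restrict_walk B (\<rho>, xs)) (restrict_walk (S - B) (\<rho>, xs)) = (\<rho>, xs)"
proof -
  have C: "S - B \<in> closed_sets S \<rho> xs"
    using closed_sets_Diff[OF S walksD(1,2)[OF w] closed_sets_total[OF walksD(1,2)[OF w]] B] .
  have "perm_restrict \<rho> B (perm_restrict \<rho> (S - B) x) = \<rho> x" for x
  proof (cases "x \<in> S - B")
    case True
    then have "\<rho> x \<in> S - B" using C by (auto simp: closed_sets_def invariant_sets_def)
    then show ?thesis using True by (simp add: perm_restrict_def)
  next
    case False
    then show ?thesis
      using permutes_not_in[OF walksD(1)[OF w], of x] by (auto simp: perm_restrict_def)
  qed
  then have "perm_restrict \<rho> B \<circ> perm_restrict \<rho> (S - B) = \<rho>" by (simp add: fun_eq_iff)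
  moreover have "sort_key snd (filter (\<lambda>p. snd p \<in> B) xs @ filter (\<lambda>p. snd p \<in> S - B) xs) = xs"
  proof (rule properties_for_sort_key)
    have *: "filter (\<lambda>p. snd p \<in> S - B) xs = filter (\<lambda>p. snd p \<notin> B) xs"
      using walksD(2)[OF w] by (intro filter_cong) auto
    show "mset xs = mset (filter (\<lambda>p. snd p \<in> B) xs @ filter (\<lambda>p. snd p \<in> S - B) xs)"
      unfolding * by simp
    fix k assume "k \<in> set xs"
    show "filter (\<lambda>x. snd k = snd x) xs =
      filter (\<lambda>x. snd k = snd x) (filter (\<lambda>p. snd p \<in> B) xs @ filter (\<lambda>p. snd p \<in> S - B) xs)"
    proof -
      have "filter (\<lambda>x. snd x \<in> B \<and> snd k = snd x) xs = (if snd k \<in> B then filter (\<lambda>x. snd k = snd x) xs else [])"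
        by (auto simp: filter_empty_conv intro!: filter_cong)
      moreover have "filter (\<lambda>x. snd x \<notin> B \<and> snd k = snd x) xs = (if snd k \<in> B then [] else filter (\<lambda>x. snd k = snd x) xs)"
        by (auto simp: filter_empty_conv intro!: filter_cong)
      ultimately show ?thesis unfolding * by simp
    qed
  qed (rule walksD(4)[OF w])
  ultimately show ?thesis by (simp add: glue_walks_def restrict_walk_def)
qed

text \<open>Filtering commutes with the stable sort and each piece is already sorted, so restriction
  recovers its list. Each permutation is the identity off its own block, so disjointness recovers
  the permutations.\<close>

lemma glue_walks_in_walks:
  assumes u: "u \<in> walks B p" and v: "v \<in> walks C q" and BC: "B \<inter> C = {}"
  shows "glue_walks u v \<in> walks (B \<union> C) (p + q)"
    and "restrict_walk B (glue_walks u v) = u" and "restrict_walk C (glue_walks u v) = v"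
    and "B \<in> closed_sets (B \<union> C) (fst (glue_walks u v)) (snd (glue_walks u v))"
proof -
  obtain \<rho>1 xs1 \<rho>2 xs2 where uv: "u = (\<rho>1, xs1)" "v = (\<rho>2, xs2)" by (cases u, cases v)
  note U = walksD[OF u[unfolded uv]] and V = walksD[OF v[unfolded uv]]
  have "\<rho>1 \<circ> \<rho>2 permutes B \<union> C"
    by (rule permutes_compose; rule permutes_subset) (use U(1) V(1) in auto)
  then show "glue_walks u v \<in> walks (B \<union> C) (p + q)"
    using U V by (auto simp: uv glue_walks_def walks_def)
  have 1: "\<rho>1 (\<rho>2 x) = \<rho>1 x" if "x \<in> B" for x
  proof -
    have "x \<notin> C" using that BC by blast
    then show ?thesis using permutes_not_in[OF V(1)] by simp
  qed
  have 2: "\<rho>1 (\<rho>2 x) = \<rho>2 x" if "x \<in> C" for x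
  proof -
    have "\<rho>2 x \<notin> B" using that BC permutes_in_image[OF V(1), of x] by blast
    then show ?thesis using permutes_not_in[OF U(1)] by simp
  qed
  have "perm_restrict (\<rho>1 \<circ> \<rho>2) B = \<rho>1"
    using 1 permutes_not_in[OF U(1)] by (auto simp: perm_restrict_def fun_eq_iff)
  moreover have "filter (\<lambda>p. snd p \<in> B) (sort_key snd (xs1 @ xs2)) = xs1"
  proof -
    have "filter (\<lambda>p. snd p \<in> B) xs1 = xs1" "filter (\<lambda>p. snd p \<in> B) xs2 = []"
      using U(5) V(5) BC by (auto simp: filter_id_conv filter_empty_conv)
    then show ?thesis using sort_key_id_if_sorted[OF U(4)] by (simp add: filter_sort)
  qed
  ultimately show "restrict_walk B (glue_walks u v) = u"
    by (simp add: restrict_walk_def glue_walks_def uv)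
  have "perm_restrict (\<rho>1 \<circ> \<rho>2) C = \<rho>2"
    using 2 permutes_not_in[OF V(1)] by (auto simp: perm_restrict_def fun_eq_iff)
  moreover have "filter (\<lambda>p. snd p \<in> C) (sort_key snd (xs1 @ xs2)) = xs2"
  proof -
    have "filter (\<lambda>p. snd p \<in> C) xs2 = xs2" "filter (\<lambda>p. snd p \<in> C) xs1 = []"
      using U(5) V(5) BC by (auto simp: filter_id_conv filter_empty_conv)
    then show ?thesis using sort_key_id_if_sorted[OF V(4)] by (simp add: filter_sort)
  qed
  ultimately show "restrict_walk C (glue_walks u v) = v"
    by (simp add: restrict_walk_def glue_walks_def uv)
  show "B \<in> closed_sets (B \<union> C) (fst (glue_walks u v)) (snd (glue_walks u v))"
    using 1 permutes_in_image[OF U(1)] U(5) V(5) BC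
    by (auto simp: closed_sets_def invariant_sets_def glue_walks_def uv)
qed

text \<open>A monoid homomorphism from pairs of multisets under addition to the ring under
  multiplication. Cycle types add over blocks, hence weights multiply.\<close>

definition multiplicative_weight :: "(nat multiset \<Rightarrow> nat multiset \<Rightarrow> 'r::comm_semiring_1) \<Rightarrow> bool" where
  "multiplicative_weight g \<longleftrightarrow> g {#} {#} = 1 \<and>
     (\<forall>\<alpha> \<alpha>' \<beta> \<beta>'. g (\<alpha> + \<alpha>') (\<beta> + \<beta>') = g \<alpha> \<beta> * g \<alpha>' \<beta>')"

lemma walk_weight_split:
  fixes g :: "nat multiset \<Rightarrow> nat multiset \<Rightarrow> 'r::comm_semiring_1"
  assumes g: "multiplicative_weight g"
    and S: "finite S" and w: "(\<rho>, xs) \<in> walks S r" and B: "B \<in> closed_sets S \<rho> xs"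
  shows "walk_weight g S (\<rho>, xs) =
    walk_weight g B (restrict_walk B (\<rho>, xs)) * walk_weight g (S - B) (restrict_walk (S - B) (\<rho>, xs))"
proof -
  let ?\<sigma> = "walk_end \<rho> xs"
  have C: "S - B \<in> closed_sets S \<rho> xs"
    using closed_sets_Diff[OF S walksD(1,2)[OF w] closed_sets_total[OF walksD(1,2)[OF w]] B] .
  have D: "D \<subseteq> S \<and> \<rho> ` D \<subseteq> D \<and> (\<forall>(i, j)\<in>set xs. i \<in> D \<longleftrightarrow> j \<in> D)" if "D \<in> closed_sets S \<rho> xs" for D
    using that by (simp add: closed_sets_def invariant_sets_def)
  have \<sigma>: "?\<sigma> permutes S" using walksD(1,2)[OF w] by (rule walk_end_permutes)
  have ends: "walk_end (perm_restrict \<rho> E) (filter (\<lambda>p. snd p \<in> E) xs) = perm_restrict ?\<sigma> E"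
    if "E \<in> closed_sets S \<rho> xs" for E
    using D[OF that] by (intro walk_end_restrict) blast
  have types: "cyc_type S \<pi> = cyc_type B (perm_restrict \<pi> B) + cyc_type (S - B) (perm_restrict \<pi> (S - B))"
    if "\<pi> permutes S" "\<pi> ` B \<subseteq> B" "\<pi> ` (S - B) \<subseteq> S - B" for \<pi>
    using D[OF B] that by (intro cyc_type_split[OF S]) blast+
  have "cyc_type S \<rho> = cyc_type B (perm_restrict \<rho> B) + cyc_type (S - B) (perm_restrict \<rho> (S - B))"
    using D[OF B] D[OF C] by (intro types walksD(1)[OF w]) blast+
  moreover have "cyc_type S ?\<sigma> = cyc_type B (perm_restrict ?\<sigma> B) + cyc_type (S - B) (perm_restrict ?\<sigma> (S - B))"
    by (intro types \<sigma> walk_end_invariant[OF B] walk_end_invariant[OF C])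
  moreover have "g (\<alpha> + \<alpha>') (\<beta> + \<beta>') = g \<alpha> \<beta> * g \<alpha>' \<beta>'" for \<alpha> \<alpha>' \<beta> \<beta>'
    using g by (simp add: multiplicative_weight_def)
  ultimately show ?thesis
    by (simp only: walk_weight_def restrict_walk_def fst_conv snd_conv ends[OF B] ends[OF C])
qed

text \<open>Once the component \<open>B\<close> of \<open>s\<close> is prescribed, the piece on
  \<open>B\<close> is a connected walk and the piece on the complement is arbitrary; the only
  coupling is that the lengths add up to \<open>r\<close>.\<close>

lemma bij_betw_glue:
  assumes S: "finite S" and s: "s \<in> B" and BS: "B \<subseteq> S"
  shows "bij_betw (\<lambda>(p, u, v). glue_walks u v)
    (SIGMA p:{..r}. connected_walks B p \<times> walks (S - B) (r - p))
    {w \<in> walks S r. component s S w = B}"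
proof (rule bij_betw_byWitness[where f' = "\<lambda>w. (length (snd (restrict_walk B w)), restrict_walk B w, restrict_walk (S - B) w)"])
  let ?D = "SIGMA p:{..r}. connected_walks B p \<times> walks (S - B) (r - p)"
  have BC: "B \<inter> (S - B) = {}" "B \<union> (S - B) = S" using BS by auto
  have sub: "connected_walks B p \<subseteq> walks B p" for p by (auto simp: connected_walks_def)
  have glue: "glue_walks u v \<in> walks S r \<and> component s S (glue_walks u v) = B \<and>
      length (snd u) = p \<and> restrict_walk B (glue_walks u v) = u \<and> restrict_walk (S - B) (glue_walks u v) = v"
    if p: "p \<le> r" and u: "u \<in> connected_walks B p" and v: "v \<in> walks (S - B) (r - p)" for p u v
  proof -
    have uw: "u \<in> walks B p" using u sub by blast
    note G = glue_walks_in_walks[OF uw v BC(1), unfolded BC(2)]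
    obtain \<rho> xs where w: "glue_walks u v = (\<rho>, xs)" by (cases "glue_walks u v")
    have "(\<rho>, xs) \<in> walks S r" using G(1) p w by simp
    moreover have "closed_sets B (perm_restrict \<rho> B) (filter (\<lambda>p. snd p \<in> B) xs) \<subseteq> {{}, B}"
      using u G(2) unfolding w restrict_walk_def connected_walks_def by auto
    moreover have "B \<in> closed_sets S \<rho> xs" using G(4) w by simp
    ultimately have "component s S (glue_walks u v) = B"
      using component_eq_iff[of \<rho> xs S r s B] s S BS w by simp
    then show ?thesis using G p uw by (auto simp: walks_def)
  qed
  show "\<forall>a\<in>?D. (length (snd (restrict_walk B ((\<lambda>(p, u, v). glue_walks u v) a))),
      restrict_walk B ((\<lambda>(p, u, v). glue_walks u v) a), restrict_walk (S - B) ((\<lambda>(p, u, v). glue_walks u v) a)) = a"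
    using glue by auto
  show "(\<lambda>(p, u, v). glue_walks u v) ` ?D \<subseteq> {w \<in> walks S r. component s S w = B}"
    using glue by auto
  have restr: "B \<in> closed_sets S \<rho> xs \<and> restrict_walk B (\<rho>, xs) \<in> connected_walks B (length (filter (\<lambda>p. snd p \<in> B) xs)) \<and>
    restrict_walk (S - B) (\<rho>, xs) \<in> walks (S - B) (r - length (filter (\<lambda>p. snd p \<in> B) xs)) \<and>
    length (filter (\<lambda>p. snd p \<in> B) xs) \<le> r"
    if w: "(\<rho>, xs) \<in> walks S r" and c: "component s S (\<rho>, xs) = B" for \<rho> xs
  proof -
    have B: "B \<in> closed_sets S \<rho> xs"
      and conn: "closed_sets B (perm_restrict \<rho> B) (filter (\<lambda>p. snd p \<in> B) xs) \<subseteq> {{}, B}"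
      using component_eq_iff[OF w s S BS] c by auto
    have C: "S - B \<in> closed_sets S \<rho> xs"
      using closed_sets_Diff[OF S walksD(1,2)[OF w] closed_sets_total[OF walksD(1,2)[OF w]] B] .
    have *: "filter (\<lambda>p. snd p \<in> S - B) xs = filter (\<lambda>p. snd p \<notin> B) xs"
      using walksD(2)[OF w] by (intro filter_cong) auto
    have len: "length (filter (\<lambda>p. snd p \<in> B) xs) + length (filter (\<lambda>p. snd p \<in> S - B) xs) = r"
      unfolding * using sum_length_filter_compl[of "\<lambda>p. snd p \<in> B" xs] walksD(3)[OF w] by simp
    show ?thesis
      using restrict_walk_in_walks[OF w B S] restrict_walk_in_walks[OF w C S] conn B len
      by (auto simp: connected_walks_def restrict_walk_def)
  qed
  show "\<forall>w\<in>{w \<in> walks S r. component s S w = B}. (\<lambda>(p, u, v). glue_walks u v)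
      (length (snd (restrict_walk B w)), restrict_walk B w, restrict_walk (S - B) w) = w"
    using restr glue_restrict[OF _ _ S] by auto
  show "(\<lambda>w. (length (snd (restrict_walk B w)), restrict_walk B w, restrict_walk (S - B) w)) `
      {w \<in> walks S r. component s S w = B} \<subseteq> ?D"
  proof (rule image_subsetI)
    fix w assume w: "w \<in> {w \<in> walks S r. component s S w = B}"
    obtain \<rho> xs where "w = (\<rho>, xs)" by (cases w)
    then show "(length (snd (restrict_walk B w)), restrict_walk B w, restrict_walk (S - B) w) \<in> ?D"
      using restr[of \<rho> xs] w by (simp add: restrict_walk_def)
  qed
qed

section \<open>Generating series in the length of the walk\<close>

definition walk_series :: "(nat multiset \<Rightarrow> nat multiset \<Rightarrow> 'r::comm_semiring_1) \<Rightarrow> 'a::linorder set \<Rightarrow> 'r fps" where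
  "walk_series g S = Abs_fps (\<lambda>r. \<Sum>w\<in>walks S r. walk_weight g S w)"

definition connected_series :: "(nat multiset \<Rightarrow> nat multiset \<Rightarrow> 'r::comm_semiring_1) \<Rightarrow> 'a::linorder set \<Rightarrow> 'r fps" where
  "connected_series g S = Abs_fps (\<lambda>r. \<Sum>w\<in>connected_walks S r. walk_weight g S w)"

text \<open>Sorting the walks by the component of \<open>s\<close> counts each of them once. Lengths
  add and weights multiply under gluing, so each component contributes a Cauchy product.\<close>

lemma walk_series_decompose:
  fixes g :: "nat multiset \<Rightarrow> nat multiset \<Rightarrow> 'r::comm_semiring_1"
  assumes g: "multiplicative_weight g"
    and S: "finite S" and s: "s \<in> S"
  shows "walk_series g S = (\<Sum>B | s \<in> B \<and> B \<subseteq> S. connected_series g B * walk_series g (S - B))"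
proof (rule fps_ext)
  fix r
  let ?\<B> = "{B. s \<in> B \<and> B \<subseteq> S}"
  have fin: "finite ?\<B>" using S by (auto intro: finite_subset[of _ "Pow S"])
  have "component s S ` walks S r \<subseteq> ?\<B>"
  proof clarify
    fix \<rho> xs assume "(\<rho>, xs) \<in> walks S r"
    from component_closed[OF this s] show "s \<in> component s S (\<rho>, xs) \<and> component s S (\<rho>, xs) \<subseteq> S"
      by (auto simp: component_def closed_sets_def invariant_sets_def)
  qed
  then have "fps_nth (walk_series g S) r = (\<Sum>B\<in>?\<B>. \<Sum>w\<in>{w \<in> walks S r. component s S w = B}. walk_weight g S w)"
    by (simp add: walk_series_def sum.group[OF finite_walks[OF S] fin])
  also have "\<dots> = (\<Sum>B\<in>?\<B>. \<Sum>p\<le>r. \<Sum>u\<in>connected_walks B p. \<Sum>v\<in>walks (S - B) (r - p).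
      walk_weight g B u * walk_weight g (S - B) v)"
  proof (rule sum.cong[OF refl])
    fix B assume B: "B \<in> ?\<B>"
    then have finB: "finite B" using S finite_subset by blast
    have fins: "finite (connected_walks B p)" "finite (walks (S - B) p)" for p
      using finite_walks[OF finB] finite_walks[of "S - B"] S
      by (auto simp: connected_walks_def intro: finite_subset[OF _ finite_walks[OF finB]])
    have BC: "B \<inter> (S - B) = {}" "B \<union> (S - B) = S" using B by auto
    have "walk_weight g S (glue_walks u v) = walk_weight g B u * walk_weight g (S - B) v"
      if u: "u \<in> connected_walks B p" and v: "v \<in> walks (S - B) q" for p q u v
    proof -
      have "u \<in> walks B p" using u by (auto simp: connected_walks_def)
      note G = glue_walks_in_walks[OF this v BC(1), unfolded BC(2)]
      obtain \<rho> xs where w: "glue_walks u v = (\<rho>, xs)" by (cases "glue_walks u v")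
      show ?thesis
        using walk_weight_split[OF g S, of \<rho> xs "p + q" B] G by (simp add: w)
    qed
    then have "(\<Sum>w\<in>{w \<in> walks S r. component s S w = B}. walk_weight g S w) =
        (\<Sum>(p, u, v)\<in>(SIGMA p:{..r}. connected_walks B p \<times> walks (S - B) (r - p)).
          walk_weight g B u * walk_weight g (S - B) v)"
      using B S
      by (subst sum.reindex_bij_betw[OF bij_betw_glue, symmetric]) (auto intro!: sum.cong)
    also have "\<dots> = (\<Sum>p\<le>r. \<Sum>u\<in>connected_walks B p. \<Sum>v\<in>walks (S - B) (r - p).
      walk_weight g B u * walk_weight g (S - B) v)"
      using fins by (simp add: sum.Sigma sum.cartesian_product)
    finally show "(\<Sum>w\<in>{w \<in> walks S r. component s S w = B}. walk_weight g S w) = \<dots>" .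
  qed
  also have "\<dots> = fps_nth (\<Sum>B\<in>?\<B>. connected_series g B * walk_series g (S - B)) r"
    by (simp add: fps_sum_nth fps_mult_nth walk_series_def connected_series_def sum_product atLeast0AtMost)
  finally show "fps_nth (walk_series g S) r = fps_nth (\<Sum>B\<in>?\<B>. connected_series g B * walk_series g (S - B)) r" .
qed

section \<open>Invariance under increasing relabellings\<close>

definition relabel_walk :: "('a \<Rightarrow> 'a) \<Rightarrow> 'a walk \<Rightarrow> 'a walk" where
  "relabel_walk f w = (f \<circ> fst w \<circ> inv' f, map (map_prod f f) (snd w))"

lemma relabel_walk_inv:
  assumes "bij f"
  shows "relabel_walk (inv' f) (relabel_walk f w) = w"
  using assms
  by (cases w) (auto simp: relabel_walk_def fun_eq_iff inv_inv_eq bij_is_inj map_prod_compose map_idI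
      intro!: map_idI)

text \<open>Conjugation needs \<open>f\<close> to be bijective on the whole type, but monotonicity
  is needed on \<open>S\<close> alone, where all pairs of the walk lie.\<close>

lemma relabel_walk_in_walks:
  assumes f: "bij f" "strict_mono_on S f" and w: "w \<in> walks S r"
  shows "relabel_walk f w \<in> walks (f ` S) r"
proof -
  obtain \<rho> xs where wp: "w = (\<rho>, xs)" by (cases w)
  note W = walksD[OF w[unfolded wp]]
  have "f \<circ> \<rho> \<circ> inv' f permutes f ` S"
  proof (rule bij_imp_permutes)
    have "bij_betw f S (f ` S)" using f(1) by (metis bij_betw_subset subset_UNIV)
    moreover have "bij_betw (inv' f) (f ` S) S"
      using f(1) by (intro bij_betw_byWitness[where f' = f]) (auto simp: bij_is_inj)
    ultimately show "bij_betw (f \<circ> \<rho> \<circ> inv' f) (f ` S) (f ` S)"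
      using permutes_imp_bij[OF W(1)] by (metis bij_betw_trans)
    fix x assume "x \<notin> f ` S"
    then have "inv' f x \<notin> S" using f(1) by (metis bij_inv_eq_iff image_eqI)
    then show "(f \<circ> \<rho> \<circ> inv' f) x = x"
      using f(1) permutes_not_in[OF W(1)] by (simp add: bij_is_surj surj_f_inv_f)
  qed
  moreover have "sorted (map snd (map (map_prod f f) xs))"
  proof -
    have "snd p \<in> S" if "p \<in> set xs" for p using that W(2) by auto
    then have "f (snd p) \<le> f (snd q)" if "p \<in> set xs" "q \<in> set xs" "snd p \<le> snd q" for p q
      using that strict_mono_on_leD[OF f(2)] by blast
    then show ?thesis
      using W(4) by (simp add: sorted_iff_nth_mono)
  qed
  ultimately show ?thesis
    using W(3,5) strict_mono_onD[OF f(2)] by (fastforce simp: walks_def relabel_walk_def wp)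
qed

lemma orbit_relabel:
  assumes "finite S" "\<pi> permutes S" "bij f"
  shows "orbit (f \<circ> \<pi> \<circ> inv' f) (f x) = f ` orbit \<pi> x"
  by (rule orbit_inverse[symmetric])
    (use assms in \<open>simp_all add: self_in_orbit_permutes bij_is_inj\<close>)

lemma cyc_type_relabel:
  assumes "finite S" "\<pi> permutes S" "bij f"
  shows "cyc_type (f ` S) (f \<circ> \<pi> \<circ> inv' f) = cyc_type S \<pi>"
proof -
  have inj: "inj f" using assms(3) by (rule bij_is_inj)
  have "orbit (f \<circ> \<pi> \<circ> inv' f) ` (f ` S) = (`) f ` (orbit \<pi> ` S)"
    unfolding image_image by (intro image_cong refl orbit_relabel[OF assms])
  then have "mset_set (orbit (f \<circ> \<pi> \<circ> inv' f) ` (f ` S)) = image_mset ((`) f) (mset_set (orbit \<pi> ` S))"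
    using inj by (simp add: image_mset_mset_set inj_on_def inj_image_eq_iff)
  moreover have "card \<circ> (`) f = card"
    using inj by (intro ext) (simp add: card_image inj_on_subset[OF inj])
  ultimately show ?thesis
    by (simp only: cyc_type_def image_mset.compositionality)
qed

lemma walk_end_relabel:
  assumes f: "bij f"
  shows "walk_end (f \<circ> \<rho> \<circ> inv' f) (map (map_prod f f) xs) = f \<circ> walk_end \<rho> xs \<circ> inv' f"
proof (induction xs rule: rev_induct)
  case (snoc x xs)
  obtain i j where x: "x = (i, j)" by (cases x)
  have "inv' f (transpose (f i) (f j) y) = transpose i j (inv' f y)" for y
    using f by (auto simp: transpose_def bij_is_inj bij_is_surj surj_f_inv_f inv_f_eq)
  then have "f \<circ> walk_end \<rho> xs \<circ> inv' f \<circ> transpose (f i) (f j) = f \<circ> (walk_end \<rho> xs \<circ> transpose i j) \<circ> inv' f"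
    by (simp add: fun_eq_iff)
  with snoc show ?case
    unfolding x map_append list.map map_prod_simp walk_end_snoc by (simp only:)
qed simp

lemma walk_weight_relabel:
  assumes S: "finite S" and f: "bij f" and w: "w \<in> walks S r"
  shows "walk_weight g (f ` S) (relabel_walk f w) = walk_weight g S w"
proof -
  obtain \<rho> xs where wp: "w = (\<rho>, xs)" by (cases w)
  note W = walksD[OF w[unfolded wp]]
  show ?thesis
    using cyc_type_relabel[OF S W(1) f] cyc_type_relabel[OF S walk_end_permutes[OF W(1,2)] f]
    by (simp only: wp walk_weight_def relabel_walk_def fst_conv snd_conv walk_end_relabel[OF f])
qed

lemma relabel_walk_connected:
  assumes f: "bij f" "strict_mono_on S f" and w: "w \<in> connected_walks S r"
  shows "relabel_walk f w \<in> connected_walks (f ` S) r"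
proof -
  obtain \<rho> xs where wp: "w = (\<rho>, xs)" by (cases w)
  have W: "w \<in> walks S r" "closed_sets S \<rho> xs \<subseteq> {{}, S}"
    using w by (auto simp: connected_walks_def wp)
  have "B \<in> {{}, f ` S}" if B: "B \<in> closed_sets (f ` S) (f \<circ> \<rho> \<circ> inv' f) (map (map_prod f f) xs)" for B
  proof -
    obtain A where A: "A \<subseteq> S" "B = f ` A"
      using B by (auto simp: closed_sets_def invariant_sets_def subset_image_iff)
    have inj: "f x \<in> f ` D \<longleftrightarrow> x \<in> D" for x D using f(1) by (simp add: bij_is_inj inj_image_mem_iff)
    have "f (\<rho> x) \<in> f ` A" if "x \<in> A" for x
    proof -
      have "(f \<circ> \<rho> \<circ> inv' f) ` B \<subseteq> B" using B by (simp only: closed_sets_def invariant_sets_def mem_Collect_eq)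
      then have "(f \<circ> \<rho> \<circ> inv' f) (f x) \<in> f ` A" using that A(2) by blast
      then show ?thesis using f(1) by (simp add: bij_is_inj)
    qed
    then have "\<rho> ` A \<subseteq> A" unfolding inj by blast
    moreover have "\<forall>(i, j)\<in>set xs. i \<in> A \<longleftrightarrow> j \<in> A"
    proof -
      have "\<forall>(i, j)\<in>set xs. f i \<in> B \<longleftrightarrow> f j \<in> B" using B by (auto simp: closed_sets_def)
      then show ?thesis unfolding A(2) inj .
    qed
    ultimately have "A \<in> closed_sets S \<rho> xs"
      using A(1) by (simp add: closed_sets_def invariant_sets_def)
    then show ?thesis using W(2) A(2) by auto
  qed
  then show ?thesis
    using relabel_walk_in_walks[OF f W(1)] by (auto simp: connected_walks_def relabel_walk_def wp)
qed

lemma series_relabel: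
  fixes f :: "'a::linorder \<Rightarrow> 'a"
  assumes S: "finite S" and f: "bij f" "strict_mono_on S f"
  shows "walk_series g (f ` S) = walk_series g S"
    and "connected_series g (f ` S) = connected_series g S"
proof -
  have inj: "inj f" using f(1) by (rule bij_is_inj)
  have f': "bij (inv' f)" "strict_mono_on (f ` S) (inv' f)"
    using f strict_mono_on_less[OF f(2)] inj by (auto simp: bij_imp_bij_inv intro!: strict_mono_onI)
  have SS: "inv' f ` f ` S = S" using inj by (simp add: image_comp)
  have r: "relabel_walk (inv' f) (relabel_walk f w) = w" "relabel_walk f (relabel_walk (inv' f) w) = w" for w
    using relabel_walk_inv[OF f(1)] relabel_walk_inv[OF f'(1)] f(1) by (simp_all add: inv_inv_eq)
  have "(\<Sum>w\<in>walks (f ` S) r. walk_weight g (f ` S) w) = (\<Sum>w\<in>walks S r. walk_weight g S w)" for r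
    by (rule sum.reindex_bij_witness[of _ "relabel_walk f" "relabel_walk (inv' f)"])
      (use r relabel_walk_in_walks[OF f] relabel_walk_in_walks[OF f', unfolded SS]
        walk_weight_relabel[OF _ f'(1), of "f ` S", unfolded SS] S in auto)
  then show "walk_series g (f ` S) = walk_series g S" by (simp add: walk_series_def)
  have "(\<Sum>w\<in>connected_walks (f ` S) r. walk_weight g (f ` S) w) = (\<Sum>w\<in>connected_walks S r. walk_weight g S w)" for r
    by (rule sum.reindex_bij_witness[of _ "relabel_walk f" "relabel_walk (inv' f)"])
      (use r relabel_walk_connected[OF f] relabel_walk_connected[OF f', unfolded SS]
        walk_weight_relabel[OF _ f'(1), of "f ` S", unfolded SS] S in \<open>auto simp: connected_walks_def\<close>)
  then show "connected_series g (f ` S) = connected_series g S" by (simp add: connected_series_def)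
qed

text \<open>An increasing bijection of all natural numbers would be the identity, so the increasing
  enumeration of \<open>S\<close> is completed without regard to order:
  \<open>S - {1..card S}\<close> and \<open>{1..card S} - S\<close> have equal size and are matched,
  and all remaining numbers are fixed.\<close>

lemma ex_relabelling:
  fixes S :: "nat set"
  assumes S: "finite S"
  obtains f where "bij f" "strict_mono_on {1..card S} f" "f ` {1..card S} = S"
proof -
  let ?T = "{1..card S}"
  obtain h where h: "bij_betw h {..<card S} S" "strict_mono_on {..<card S} h"
    using ex_bij_betw_strict_mono_card[OF S] .
  have "bij_betw (\<lambda>i. i - 1) ?T {..<card S}"
    by (rule bij_betw_byWitness[where f' = Suc]) auto
  then have b1: "bij_betw (\<lambda>i. h (i - 1)) ?T S"
    using bij_betw_trans[OF _ h(1)] by (simp add: comp_def)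
  have "card (S - ?T) = card (?T - S)"
    using S card_Diff_subset_Int[of S ?T] card_Diff_subset_Int[of ?T S] by (simp add: Int_commute)
  then obtain k where k: "bij_betw k (S - ?T) (?T - S)"
    using S finite_same_card_bij[of "S - ?T" "?T - S"] by auto
  define f where "f i = (if i \<in> ?T then h (i - 1) else if i \<in> S then k i else i)" for i
  have "bij_betw f ?T S" using b1 by (rule bij_betw_cong[THEN iffD1, rotated]) (simp add: f_def)
  moreover have "bij_betw f (S - ?T) (?T - S)"
    using k by (rule bij_betw_cong[THEN iffD1, rotated]) (auto simp: f_def)
  ultimately have "bij_betw f (?T \<union> (S - ?T)) (S \<union> (?T - S))" by (rule bij_betw_combine) auto
  moreover have "bij_betw f (- (?T \<union> S)) (- (?T \<union> S))"
    by (rule bij_betw_cong[THEN iffD1, OF _ bij_betw_id]) (auto simp: f_def)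
  ultimately have "bij_betw f (?T \<union> (S - ?T) \<union> - (?T \<union> S)) (S \<union> (?T - S) \<union> - (?T \<union> S))"
    by (rule bij_betw_combine) auto
  moreover have "?T \<union> (S - ?T) \<union> - (?T \<union> S) = UNIV" "S \<union> (?T - S) \<union> - (?T \<union> S) = UNIV" by auto
  ultimately have "bij f" by simp
  moreover have "strict_mono_on ?T f"
    by (rule strict_mono_onI) (auto simp: f_def intro!: strict_mono_onD[OF h(2)])
  moreover have "f ` ?T = S" using \<open>bij_betw f ?T S\<close> by (simp add: bij_betw_def)
  ultimately show ?thesis using that by blast
qed

lemma series_card:
  fixes S :: "nat set"
  assumes "finite S"
  shows "walk_series g S = walk_series g {1..card S}"
    and "connected_series g S = connected_series g {1..card S}"
proof -
  obtain f where "bij f" "strict_mono_on {1..card S} f" "f ` {1..card S} = S"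
    using ex_relabelling[OF assms] .
  then show "walk_series g S = walk_series g {1..card S}"
    "connected_series g S = connected_series g {1..card S}"
    using series_relabel[of "{1..card S}" f g] by simp_all
qed

section \<open>The recurrence between all walks and connected walks\<close>

lemma card_subsets_containing:
  assumes "finite S" "s \<in> S"
  shows "card {B. s \<in> B \<and> B \<subseteq> S \<and> card B = Suc k} = (card S - 1) choose k"
proof -
  have fin: "finite A" if "A \<subseteq> S" for A using that assms(1) by (rule finite_subset)
  have "bij_betw (insert s) {A. A \<subseteq> S - {s} \<and> card A = k} {B. s \<in> B \<and> B \<subseteq> S \<and> card B = Suc k}"
    by (rule bij_betw_byWitness[where f' = "\<lambda>B. B - {s}"])
      (use assms fin in \<open>auto simp: card_insert_if card_Diff_singleton_if subset_Diff_insert\<close>)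
  then show ?thesis
    using n_subsets[of "S - {s}" k] assms by (simp add: bij_betw_same_card[symmetric])
qed

text \<open>The component of the point \<open>1\<close> is split off. By relabelling only its size
  matters, and a component of size \<open>Suc k\<close> is given by choosing its \<open>k\<close>
  other points among \<open>n\<close>.\<close>

lemma walk_series_recurrence:
  fixes g :: "nat multiset \<Rightarrow> nat multiset \<Rightarrow> 'r::comm_semiring_1"
  assumes g: "multiplicative_weight g"
  shows "walk_series g {1..Suc n} =
    (\<Sum>k\<le>n. of_nat (n choose k) * (connected_series g {1..Suc k} * walk_series g {1..n - k}))"
proof -
  let ?S = "{1..Suc n}"
  let ?\<B> = "{B. 1 \<in> B \<and> B \<subseteq> ?S}"
  have fin: "finite ?\<B>" by (auto intro: finite_subset[of _ "Pow ?S"])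
  have sub: "(\<lambda>B. card B - 1) ` ?\<B> \<subseteq> {..n}"
  proof (rule image_subsetI)
    fix B assume "B \<in> ?\<B>"
    then have "card B \<le> card ?S" by (intro card_mono) auto
    then show "card B - 1 \<in> {..n}" by simp
  qed
  have "walk_series g ?S = (\<Sum>B\<in>?\<B>. connected_series g B * walk_series g (?S - B))"
    by (rule walk_series_decompose[OF g]) simp_all
  also have "\<dots> = (\<Sum>k\<le>n. \<Sum>B | B \<in> ?\<B> \<and> card B - 1 = k. connected_series g B * walk_series g (?S - B))"
    by (rule sum.group[OF fin _ sub, symmetric]) simp
  also have "\<dots> = (\<Sum>k\<le>n. of_nat (n choose k) * (connected_series g {1..Suc k} * walk_series g {1..n - k}))"
  proof (rule sum.cong[OF refl])
    fix k assume k: "k \<in> {..n}"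
    \<comment> \<open>Subtraction truncates at zero, so \<open>B\<close> must be known to be
      nonempty before \<open>card B - 1 = k\<close> can be read as
      \<open>card B = Suc k\<close>.\<close>
    have pos: "0 < card B" if "B \<in> ?\<B>" for B
      using that finite_subset[of B ?S] by (auto simp: card_gt_0_iff)
    have eq: "{B. B \<in> ?\<B> \<and> card B - 1 = k} = {B. 1 \<in> B \<and> B \<subseteq> ?S \<and> card B = Suc k}"
    proof (rule Collect_cong)
      fix B show "B \<in> ?\<B> \<and> card B - 1 = k \<longleftrightarrow> 1 \<in> B \<and> B \<subseteq> ?S \<and> card B = Suc k"
        using pos[of B] by (cases "card B") auto
    qed
    have "connected_series g B * walk_series g (?S - B) = connected_series g {1..Suc k} * walk_series g {1..n - k}"
      if "1 \<in> B \<and> B \<subseteq> ?S \<and> card B = Suc k" for B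
    proof -
      have B: "finite B" "card (?S - B) = n - k"
        using that finite_subset[of B ?S] by (auto simp: card_Diff_subset)
      show ?thesis using series_card[OF B(1), of g] series_card(1)[of "?S - B" g] that B(2) by simp
    qed
    then show "(\<Sum>B | B \<in> ?\<B> \<and> card B - 1 = k. connected_series g B * walk_series g (?S - B)) =
      of_nat (n choose k) * (connected_series g {1..Suc k} * walk_series g {1..n - k})"
      unfolding eq using card_subsets_containing[of ?S 1 k] by simp
  qed
  finally show ?thesis .
qed

lemma walk_series_empty:
  assumes "multiplicative_weight g"
  shows "walk_series g {1..0::nat} = 1"
proof -
  have "w \<in> walks {} r \<longleftrightarrow> w = (id, []) \<and> r = 0" for w :: "nat walk" and r
  proof (cases w)
    case (Pair \<rho> xs)
    then show ?thesis by (cases xs) (auto simp: walks_def)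
  qed
  then have "walks {} r = (if r = 0 then {(id, [])} else ({} :: nat walk set))" for r
    by (simp add: set_eq_iff)
  then show ?thesis
    using assms by (simp add: walk_series_def fps_eq_iff walk_weight_def cyc_type_def multiplicative_weight_def)
qed

section \<open>Monotone walks and Hurwitz numbers\<close>

definition transpositions :: "('a \<times> 'a) list \<Rightarrow> ('a \<Rightarrow> 'a) list" where
  "transpositions xs = map (\<lambda>(i, j). transpose i j) xs"

lemma foldl_transpositions: "foldl (\<circ>) \<rho> (transpositions xs) = walk_end \<rho> xs"
proof (induction xs rule: rev_induct)
  case (snoc x xs)
  then show ?case by (cases x) (simp only: transpositions_def map_append foldl_append walk_end_snoc list.map foldl.simps prod.case)
qed (simp add: transpositions_def)

lemma cycle_type_eq: "cycle_type d \<pi> = cyc_type {1..d} \<pi>"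
  by (simp add: cycle_type_def cyc_type_def)

text \<open>The points moved by a transposition are its two entries, and \<open>i < j\<close> orders
  them. Hence the transpositions determine the list of pairs, which \<open>monotone_walks\<close>
  only asserts to exist.\<close>

lemma transpose_inj:
  fixes i j k l :: nat
  assumes "i < j" "k < l" "transpose i j = transpose k l"
  shows "i = k \<and> j = l"
proof -
  have "{x. transpose i j x \<noteq> x} = {x. transpose k l x \<noteq> x}" using assms(3) by simp
  moreover have "{x. transpose i j x \<noteq> x} = {i, j}" "{x. transpose k l x \<noteq> x} = {k, l}"
    using assms(1,2) by (auto simp: transpose_def)
  ultimately have "{i, j} = {k, l}" by simp
  then show ?thesis using assms(1,2) by (auto simp: doubleton_eq_iff)
qed

lemma bij_betw_monotone_walks:
  "bij_betw (\<lambda>w. (fst w, transpositions (snd w)))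
     {w \<in> walks {1..d} r. cyc_type {1..d} (fst w) = \<alpha> \<and> cyc_type {1..d} (walk_end (fst w) (snd w)) = \<beta>}
     (monotone_walks d r \<alpha> \<beta>)" (is "bij_betw ?f ?W _")
proof (rule bij_betw_imageI)
  have "inj_on (\<lambda>(i, j). transpose i j) {(i, j). i < (j::nat)}"
    using transpose_inj by (fastforce simp: inj_on_def)
  then have "inj_on (map (\<lambda>(i, j). transpose i j)) (lists {(i, j). i < (j::nat)})"
    by (rule inj_on_mapI[OF inj_on_subset]) auto
  then have inj: "inj_on transpositions (lists {(i, j). i < (j::nat)})"
    by (simp add: transpositions_def[abs_def])
  have lists: "snd w \<in> lists {(i, j). i < j}" if "w \<in> ?W" for w
    using that by (auto simp: walks_def)
  show "inj_on ?f ?W"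
  proof (rule inj_onI)
    fix v w assume vw: "v \<in> ?W" "w \<in> ?W" "?f v = ?f w"
    then have "transpositions (snd v) = transpositions (snd w)" "fst v = fst w" by auto
    then show "v = w" using inj_onD[OF inj _ lists[OF vw(1)] lists[OF vw(2)]] by (simp add: prod_eqI)
  qed
  show "?f ` ?W = monotone_walks d r \<alpha> \<beta>"
  proof (intro equalityI subsetI)
    fix v assume "v \<in> ?f ` ?W"
    then obtain \<rho> xs where v: "v = (\<rho>, transpositions xs)" and w: "(\<rho>, xs) \<in> walks {1..d} r"
      and t: "cyc_type {1..d} \<rho> = \<alpha>" "cyc_type {1..d} (walk_end \<rho> xs) = \<beta>" by auto
    have "\<forall>(i, j)\<in>set xs. 1 \<le> i \<and> i < j \<and> j \<le> d" using walksD(5)[OF w] by auto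
    then have "\<exists>ijs. transpositions xs = map (\<lambda>(i, j). transpose i j) ijs \<and>
        (\<forall>(i, j)\<in>set ijs. 1 \<le> i \<and> i < j \<and> j \<le> d) \<and> sorted (map snd ijs)"
      using walksD(4)[OF w] unfolding transpositions_def by blast
    moreover have "length (transpositions xs) = r" using walksD(3)[OF w] by (simp add: transpositions_def)
    ultimately show "v \<in> monotone_walks d r \<alpha> \<beta>"
      using walksD(1)[OF w] t
      unfolding v monotone_walks_def cycle_type_eq sym_group_carrier mem_Collect_eq prod.case foldl_transpositions by blast
  next
    fix v assume v: "v \<in> monotone_walks d r \<alpha> \<beta>"
    then obtain \<rho> xs where x: "v = (\<rho>, transpositions xs)" "\<forall>(i, j)\<in>set xs. 1 \<le> i \<and> i < j \<and> j \<le> d" "sorted (map snd xs)"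
      unfolding monotone_walks_def transpositions_def by blast
    then have "(\<rho>, xs) \<in> walks {1..d} r"
      using v by (auto simp: monotone_walks_def walks_def transpositions_def sym_group_carrier)
    then have "(\<rho>, xs) \<in> ?W"
      using v by (simp add: x monotone_walks_def cycle_type_eq foldl_transpositions)
    then show "v \<in> ?f ` ?W" by (intro image_eqI[where x = "(\<rho>, xs)"]) (simp_all add: x)
  qed
qed

text \<open>A closed set is preserved by the generators and so by the whole group; if the group is
  transitive, a nonempty one is everything. Conversely, the orbit of a point under the group is a
  nonempty closed set.\<close>

lemma transitive_iff_connected:
  assumes w: "(\<rho>, xs) \<in> walks {1..d} r"
  shows "transitive_on d (generate (sym_group d) (insert \<rho> (set (transpositions xs)))) \<longleftrightarrow>
    closed_sets {1..d} \<rho> xs \<subseteq> {{}, {1..d}}"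
proof -
  let ?X = "insert \<rho> (set (transpositions xs))"
  let ?K = "generate (sym_group d) ?X"
  note W = walksD[OF w]
  have X: "h permutes {1..d}" if "h \<in> ?X" for h
  proof (cases "h = \<rho>")
    case False
    then obtain i j where "(i, j) \<in> set xs" "h = transpose i j"
      using \<open>h \<in> ?X\<close> False by (auto simp: transpositions_def)
    then show ?thesis using W(2) by (auto intro!: permutes_swap_id)
  qed (use W(1) in simp)
  have X_inv: "inv\<^bsub>sym_group d\<^esub> h = inv' h" if "h \<in> ?X" for h
    using X[OF that] by (intro sym_group_inv_equality) (simp add: sym_group_carrier)
  have K_permutes: "\<pi> permutes {1..d}" if "\<pi> \<in> ?K" for \<pi>
    using that
  proof induction
    case (inv h)
    have "inv' h permutes {1..d}" using X[OF inv] by (rule permutes_inv)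
    then show ?case by (simp only: X_inv[OF inv])
  next
    case one show ?case unfolding sym_group_one by (rule permutes_id)
  next
    case (incl h) then show ?case by (rule X)
  next
    case (eng h1 h2)
    then show ?case unfolding sym_group_mult by (intro permutes_compose)
  qed
  have preserves: "\<pi> ` B \<subseteq> B" if B: "B \<in> closed_sets {1..d} \<rho> xs" and \<pi>: "\<pi> \<in> ?K" for B \<pi>
  proof -
    \<comment> \<open>Equality rather than inclusion, so that inverses of generators preserve
      \<open>B\<close> as well.\<close>
    have gen: "h ` B = B" if "h \<in> ?X" for h
    proof (cases "h = \<rho>")
      case True
      then show ?thesis
        using B invariant_sets_image[OF _ W(1)] by (simp add: closed_sets_def)
    next
      case False
      then obtain i j where ij: "(i, j) \<in> set xs" "h = transpose i j"
        using \<open>h \<in> ?X\<close> False by (auto simp: transpositions_def)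
      then have "i \<in> B \<longleftrightarrow> j \<in> B" using B by (auto simp: closed_sets_def)
      then show ?thesis unfolding ij(2) by (rule transpose_image_eq)
    qed
    show ?thesis
      using \<pi>
    proof induction
      case one then show ?case by (simp add: sym_group_one)
    next
      case (incl h) then show ?case using gen by blast
    next
      case (inv h)
      have "inv' h ` (h ` B) = B" using permutes_inj[OF X[OF inv]] by (simp add: image_comp)
      then show ?case using gen[OF inv] by (simp add: X_inv[OF inv])
    next
      case (eng h1 h2)
      then show ?case unfolding sym_group_mult image_comp[symmetric] by blast
    qed
  qed
  show ?thesis
  proof
    assume tr: "transitive_on d ?K"
    have "{1..d} \<subseteq> B" if B: "B \<in> closed_sets {1..d} \<rho> xs" "x \<in> B" for B x
    proof
      fix y assume "y \<in> {1..d}"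
      moreover have "x \<in> {1..d}" using B by (auto simp: closed_sets_def invariant_sets_def)
      ultimately obtain \<pi> where "\<pi> \<in> ?K" "\<pi> x = y" using tr unfolding transitive_on_def by blast
      then show "y \<in> B" using preserves[OF B(1)] B(2) by blast
    qed
    moreover have "B \<subseteq> {1..d}" if "B \<in> closed_sets {1..d} \<rho> xs" for B
      using that by (simp add: closed_sets_def invariant_sets_def)
    ultimately show "closed_sets {1..d} \<rho> xs \<subseteq> {{}, {1..d}}" by blast
  next
    assume conn: "closed_sets {1..d} \<rho> xs \<subseteq> {{}, {1..d}}"
    show "transitive_on d ?K"
      unfolding transitive_on_def
    proof (intro ballI)
      fix x y assume xy: "x \<in> {1..d}" "y \<in> {1..d}"
      define B where "B = (\<lambda>\<pi>. \<pi> x) ` ?K"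
      have mult: "h z \<in> B" if "h \<in> ?X" "z \<in> B" for h z
      proof -
        obtain \<pi> where \<pi>: "\<pi> \<in> ?K" "z = \<pi> x" using \<open>z \<in> B\<close> by (auto simp: B_def)
        have "h \<circ> \<pi> \<in> ?K" using generate.eng[OF generate.incl[OF that(1)] \<pi>(1)] by (simp only: sym_group_mult)
        then show ?thesis unfolding B_def \<pi>(2) by (intro image_eqI[where x = "h \<circ> \<pi>"]) simp
      qed
      have "transpose i j \<in> ?X" if "(i, j) \<in> set xs" for i j
        using that by (force simp: transpositions_def)
      \<comment> \<open>The transposition exchanges \<open>i\<close> and \<open>j\<close>, so
        applying \<open>mult\<close> at either point gives both directions.\<close>
      then have "i \<in> B \<longleftrightarrow> j \<in> B" if "(i, j) \<in> set xs" for i j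
        using mult[of "transpose i j"] that by fastforce
      moreover have "\<rho> ` B \<subseteq> B" using mult by blast
      moreover have "B \<subseteq> {1..d}"
        unfolding B_def using permutes_in_image[OF K_permutes, of _ x] xy(1) by (intro image_subsetI) simp
      ultimately have "B \<in> closed_sets {1..d} \<rho> xs" by (auto simp: closed_sets_def invariant_sets_def)
      moreover have "x \<in> B"
        unfolding B_def using generate.one[of "sym_group d" ?X]
        by (intro image_eqI[where x = id]) (simp_all add: sym_group_one)
      ultimately have "B = {1..d}" using conn by blast
      then have "y \<in> (\<lambda>\<pi>. \<pi> x) ` ?K" using xy(2) unfolding B_def by (simp only:)
      then show "\<exists>\<pi>\<in>?K. \<pi> x = y" by (rule imageE) (rule bexI, rule sym)
    qed
  qed
qed

lemma walk_number_eq: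
  "walk_number d r \<alpha> \<beta> =
     card {w \<in> walks {1..d} r. cyc_type {1..d} (fst w) = \<alpha> \<and> cyc_type {1..d} (walk_end (fst w) (snd w)) = \<beta>}"
  unfolding walk_number_def by (rule bij_betw_same_card[OF bij_betw_monotone_walks, symmetric])

lemma image_Collect_restrict: "f ` {x \<in> A. P (f x)} = {y \<in> f ` A. P y}"
  by blast

lemma hurwitz_number_eq:
  "hurwitz_number d r \<alpha> \<beta> =
     card {w \<in> connected_walks {1..d} r. cyc_type {1..d} (fst w) = \<alpha> \<and> cyc_type {1..d} (walk_end (fst w) (snd w)) = \<beta>}"
proof -
  let ?f = "\<lambda>w. (fst w, transpositions (snd w))"
  let ?W = "{w \<in> walks {1..d} r. cyc_type {1..d} (fst w) = \<alpha> \<and> cyc_type {1..d} (walk_end (fst w) (snd w)) = \<beta>}"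
  let ?C = "{w \<in> connected_walks {1..d} r. cyc_type {1..d} (fst w) = \<alpha> \<and> cyc_type {1..d} (walk_end (fst w) (snd w)) = \<beta>}"
  let ?T = "\<lambda>v. transitive_on d (generate (sym_group d) (insert (fst v) (set (snd v))))"
  have C: "?C = {w \<in> ?W. ?T (?f w)}"
  proof (rule Set.set_eqI)
    fix w show "w \<in> ?C \<longleftrightarrow> w \<in> {w \<in> ?W. ?T (?f w)}"
    proof (cases "w \<in> walks {1..d} r")
      case True
      then show ?thesis
        using transitive_iff_connected[of "fst w" "snd w" d r] by (cases w) (simp add: connected_walks_def conj_ac)
    qed (auto simp: connected_walks_def)
  qed
  have "?f ` ?C = {v \<in> monotone_walks d r \<alpha> \<beta>. ?T v}"
    unfolding C bij_betw_imp_surj_on[OF bij_betw_monotone_walks[of d r \<alpha> \<beta>], symmetric]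
    by (rule image_Collect_restrict)
  moreover have "inj_on ?f ?C"
    by (rule inj_on_subset[OF bij_betw_imp_inj_on[OF bij_betw_monotone_walks[of d r \<alpha> \<beta>]]]) (auto simp: connected_walks_def)
  moreover have "{(\<rho>, \<tau>s) \<in> monotone_walks d r \<alpha> \<beta>. transitive_on d (generate (sym_group d) (insert \<rho> (set \<tau>s)))}
      = {v \<in> monotone_walks d r \<alpha> \<beta>. ?T v}" by auto
  ultimately show ?thesis unfolding hurwitz_number_def using card_image[of ?f ?C] by simp
qed

section \<open>Sums over partitions as sums over walks, and the genus\<close>

lemma finite_partitions: "finite (partitions d)"
proof (rule finite_subset)
  show "finite (mset ` {xs. set xs \<subseteq> {..d} \<and> length xs \<le> d})"
    by (intro finite_imageI finite_lists_length_le) simp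
  show "partitions d \<subseteq> mset ` {xs. set xs \<subseteq> {..d} \<and> length xs \<le> d}"
  proof
    fix \<alpha> assume \<alpha>: "\<alpha> \<in> partitions d"
    obtain xs where xs: "\<alpha> = mset xs" using ex_mset by metis
    have pos: "\<forall>k\<in>set xs. 1 \<le> k" and sum: "sum_list xs = d"
      using \<alpha> by (auto simp: partitions_def xs sum_mset_sum_list)
    have "length xs \<le> sum_list xs" using pos by (induction xs) auto
    then show "\<alpha> \<in> mset ` {xs. set xs \<subseteq> {..d} \<and> length xs \<le> d}"
      using sum member_le_sum_list by (auto simp: xs)
  qed
qed

lemma cyc_type_in_partitions:
  assumes S: "finite S" and \<pi>: "\<pi> permutes S"
  shows "cyc_type S \<pi> \<in> partitions (card S)"
proof -
  have sub: "orbit \<pi> x \<subseteq> S" if "x \<in> S" for x using permutes_orbit_subset[OF \<pi> that] .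
  then have fin: "finite A" if "A \<in> orbit \<pi> ` S" for A
    using that S finite_subset by blast
  have "pairwise disjnt (orbit \<pi> ` S)"
    using orbit_eq_of_mem[OF S \<pi>] unfolding pairwise_def disjnt_def by blast
  then have "sum card (orbit \<pi> ` S) = card (\<Union>(orbit \<pi> ` S))"
    using fin by (simp add: card_Union_disjoint)
  moreover have "\<Union>(orbit \<pi> ` S) = S"
    using sub self_in_orbit_permutes[OF S \<pi>] by blast
  moreover have "1 \<le> card A" if "A \<in> orbit \<pi> ` S" for A
    using that fin[OF that] orbit_nonempty[of \<pi>] by (auto simp: Suc_le_eq card_gt_0_iff)
  ultimately show ?thesis
    using S by (auto simp: partitions_def cyc_type_def sum_unfold_sum_mset)
qed

lemma sum_by_type:
  fixes g :: "'b \<Rightarrow> 'c \<Rightarrow> 'r::comm_semiring_1"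
  assumes "finite X" "finite P" "finite Q" "a ` X \<subseteq> P" "b ` X \<subseteq> Q"
  shows "(\<Sum>\<alpha>\<in>P. \<Sum>\<beta>\<in>Q. g \<alpha> \<beta> * of_nat (card {x \<in> X. a x = \<alpha> \<and> b x = \<beta>})) = (\<Sum>x\<in>X. g (a x) (b x))"
proof -
  have "(\<Sum>x\<in>X. g (a x) (b x)) = (\<Sum>t\<in>P \<times> Q. \<Sum>x\<in>{x \<in> X. (a x, b x) = t}. g (a x) (b x))"
    by (rule sum.group[symmetric]) (use assms in auto)
  also have "\<dots> = (\<Sum>(\<alpha>, \<beta>)\<in>P \<times> Q. g \<alpha> \<beta> * of_nat (card {x \<in> X. a x = \<alpha> \<and> b x = \<beta>}))"
    by (rule sum.cong) (auto simp: mult.commute)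
  finally show ?thesis by (simp add: sum.cartesian_product)
qed

lemma connected_walks_subset: "connected_walks S r \<subseteq> walks S r"
  by (auto simp: connected_walks_def)

lemma types_in_partitions:
  assumes "w \<in> walks {1..d} r"
  shows "cyc_type {1..d} (fst w) \<in> partitions d"
    and "cyc_type {1..d} (walk_end (fst w) (snd w)) \<in> partitions d"
proof -
  obtain \<rho> xs where w: "w = (\<rho>, xs)" by (cases w)
  note W = walksD[OF assms[unfolded w]]
  show "cyc_type {1..d} (fst w) \<in> partitions d"
    using cyc_type_in_partitions[OF _ W(1)] by (simp add: w)
  show "cyc_type {1..d} (walk_end (fst w) (snd w)) \<in> partitions d"
    using cyc_type_in_partitions[OF _ walk_end_permutes[OF W(1,2)]] by (simp add: w)
qed

text \<open>Each walk has exactly one pair of cycle types, and both are partitions of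
  \<open>d\<close>, so weighting the counts by type amounts to summing the weight over the walks
  themselves.\<close>

lemma series_eq_sum_partitions:
  fixes g :: "nat multiset \<Rightarrow> nat multiset \<Rightarrow> 'r::comm_semiring_1"
  shows "(\<Sum>\<alpha>\<in>partitions d. \<Sum>\<beta>\<in>partitions d. g \<alpha> \<beta> * of_nat (walk_number d r \<alpha> \<beta>)) =
      fps_nth (walk_series g {1..d}) r"
    and "(\<Sum>\<alpha>\<in>partitions d. \<Sum>\<beta>\<in>partitions d. g \<alpha> \<beta> * of_nat (hurwitz_number d r \<alpha> \<beta>)) =
      fps_nth (connected_series g {1..d}) r"
proof -
  have fin: "finite (walks {1..d} r)" "finite (connected_walks {1..d} r)"
    using finite_walks[of "{1..d}"] finite_subset[OF connected_walks_subset] by blast+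
  show "(\<Sum>\<alpha>\<in>partitions d. \<Sum>\<beta>\<in>partitions d. g \<alpha> \<beta> * of_nat (walk_number d r \<alpha> \<beta>)) =
      fps_nth (walk_series g {1..d}) r"
    unfolding walk_number_eq walk_series_def walk_weight_def fps_nth_Abs_fps
    by (rule sum_by_type[OF fin(1) finite_partitions finite_partitions])
      (use types_in_partitions in auto)
  show "(\<Sum>\<alpha>\<in>partitions d. \<Sum>\<beta>\<in>partitions d. g \<alpha> \<beta> * of_nat (hurwitz_number d r \<alpha> \<beta>)) =
      fps_nth (connected_series g {1..d}) r"
    unfolding hurwitz_number_eq connected_series_def walk_weight_def fps_nth_Abs_fps
    by (rule sum_by_type[OF fin(2) finite_partitions finite_partitions])
      (use types_in_partitions connected_walks_subset in blast)+
qed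

text \<open>A connected walk has at most two closed sets, so the Riemann-Hurwitz bound reads
  \<open>size \<alpha> + size \<beta> \<le> r + 2\<close>. The parity statement makes the difference
  of the two sides even, and half of it is the genus.\<close>

lemma hurwitz_number_genus:
  assumes "hurwitz_number d r \<alpha> \<beta> \<noteq> 0"
  shows "\<exists>g. int r = 2 * int g - 2 + int (size \<alpha>) + int (size \<beta>)"
proof -
  let ?S = "{1..d}"
  obtain \<rho> xs where c: "(\<rho>, xs) \<in> connected_walks ?S r"
    and t: "cyc_type ?S \<rho> = \<alpha>" "cyc_type ?S (walk_end \<rho> xs) = \<beta>"
  proof -
    have "{w \<in> connected_walks ?S r. cyc_type ?S (fst w) = \<alpha> \<and> cyc_type ?S (walk_end (fst w) (snd w)) = \<beta>} \<noteq> {}"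
      using assms unfolding hurwitz_number_eq by (intro notI) (simp only: card.empty)
    then show ?thesis by (auto intro: that)
  qed
  have w: "(\<rho>, xs) \<in> walks ?S r" and conn: "closed_sets ?S \<rho> xs \<subseteq> {{}, ?S}"
    using c by (auto simp: connected_walks_def)
  note W = walksD[OF w]
  have sizes: "size \<alpha> = card (orbit \<rho> ` ?S)" "size \<beta> = card (orbit (walk_end \<rho> xs) ` ?S)"
    by (simp_all add: t[symmetric] cyc_type_def)
  have "\<forall>(i, j)\<in>set xs. i \<noteq> j" using W(5) by auto
  then have RH: "2 ^ (size \<alpha> + size \<beta>) \<le> 2 ^ r * (card (closed_sets ?S \<rho> xs))\<^sup>2" "even (size \<alpha> + size \<beta> + r)"
    using riemann_hurwitz[of ?S \<rho> xs] W(1-3) by (simp_all add: sizes)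
  have "card (closed_sets ?S \<rho> xs) \<le> card {{}, ?S}" using conn by (intro card_mono) auto
  also have "\<dots> \<le> 2" by (simp add: card_insert_if)
  finally have "(card (closed_sets ?S \<rho> xs))\<^sup>2 \<le> 2\<^sup>2" by (rule power_mono) simp
  then have "2 ^ r * (card (closed_sets ?S \<rho> xs))\<^sup>2 \<le> 2 ^ r * 2\<^sup>2" by (rule mult_left_mono) simp
  with RH(1) have "(2::nat) ^ (size \<alpha> + size \<beta>) \<le> 2 ^ (r + 2)" unfolding power_add by linarith
  then have "size \<alpha> + size \<beta> \<le> r + 2" by (rule power_le_imp_le_exp[rotated]) simp
  moreover have "even (r + 2 - (size \<alpha> + size \<beta>))" using RH(2) calculation by simp
  then obtain h where "r + 2 - (size \<alpha> + size \<beta>) = 2 * h" by (rule evenE)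
  ultimately have "int r = 2 * int h - 2 + int (size \<alpha>) + int (size \<beta>)" by linarith
  then show ?thesis ..
qed

section \<open>The exponential formula\<close>

lemma scalar_mult: "scalar a * scalar b = scalar (a * b)"
  by (simp add: scalar_def mult_single)

lemma scalar_of_nat: "scalar (of_nat n) = of_nat n"
  unfolding scalar_def fls_of_nat of_nat_single by (simp only: comp_apply)

lemma scalar_1 [simp]: "scalar 1 = 1"
  by (simp add: scalar_def flip: single_one)

text \<open>The coefficient ring is not a field, but it contains the complex constants as
  \<open>scalar\<close>, among them the inverses of positive integers.\<close>

lemma of_nat_fls_cancel:
  fixes x y :: "'v mpoly fls"
  assumes "of_nat (Suc n) * x = of_nat (Suc n) * y"
  shows "x = y"
proof -
  have "scalar (1 / of_nat (Suc n)) * (of_nat (Suc n) * z) = z" for z :: "'v mpoly fls"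
    unfolding scalar_of_nat[symmetric] mult.assoc[symmetric] scalar_mult by (simp del: of_nat_Suc)
  then show ?thesis using assms by metis
qed

text \<open>Termwise, the derivative of \<open>S ^ Suc i\<close> over \<open>fact (Suc i)\<close> is
  \<open>fps_deriv S * S ^ i\<close> over \<open>fact i\<close>. Without constant term,
  \<open>S ^ i\<close> has no coefficients below degree \<open>i\<close>, so only finitely many
  terms matter in each degree.\<close>

lemma formal_exp_deriv:
  assumes "fps_nth S 0 = 0"
  shows "fps_deriv (formal_exp S) = fps_deriv S * formal_exp S"
proof (rule fps_ext)
  fix n
  have pow: "fps_nth (S ^ i) k = 0" if "k < i" for i k
    using startsby_zero_power_prefix[OF assms] that by blast
  have "of_nat (Suc n) * fps_nth (S ^ Suc i) (Suc n) = of_nat (Suc i) * fps_nth (fps_deriv S * S ^ i) n" for i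
  proof -
    have "of_nat (Suc n) * fps_nth (S ^ Suc i) (Suc n) = fps_nth (fps_deriv (S ^ Suc i)) n"
      by (simp only: fps_deriv_nth Suc_eq_plus1)
    also have "\<dots> = of_nat (Suc i) * fps_nth (fps_deriv S * S ^ i) n"
      by (simp add: fps_deriv_power mult.assoc del: power_Suc of_nat_Suc)
    finally show ?thesis .
  qed
  then have trm: "of_nat (Suc n) * (scalar (1 / fact (Suc i)) * fps_nth (S ^ Suc i) (Suc n)) =
      scalar (1 / fact i) * fps_nth (fps_deriv S * S ^ i) n" for i
  proof -
    have "of_nat (Suc n) * (scalar (1 / fact (Suc i)) * fps_nth (S ^ Suc i) (Suc n)) =
      scalar (1 / fact (Suc i)) * (of_nat (Suc n) * fps_nth (S ^ Suc i) (Suc n))"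
      by (rule mult.left_commute)
    also have "\<dots> = (scalar (1 / fact (Suc i)) * scalar (of_nat (Suc i))) * fps_nth (fps_deriv S * S ^ i) n"
      unfolding \<open>\<And>i. of_nat (Suc n) * fps_nth (S ^ Suc i) (Suc n) = of_nat (Suc i) * fps_nth (fps_deriv S * S ^ i) n\<close>
        scalar_of_nat mult.assoc ..
    also have "scalar (1 / fact (Suc i)) * scalar (of_nat (Suc i)) = scalar (1 / fact i)"
      unfolding scalar_mult by (simp add: divide_simps del: of_nat_Suc)
    finally show ?thesis .
  qed
  have "fps_nth (fps_deriv (formal_exp S)) n = of_nat (Suc n) * (\<Sum>i\<le>Suc n. scalar (1 / fact i) * fps_nth (S ^ i) (Suc n))"
    by (simp add: formal_exp_def fps_compose_nth atLeast0AtMost)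
  also have "\<dots> = of_nat (Suc n) * (\<Sum>i\<le>n. scalar (1 / fact (Suc i)) * fps_nth (S ^ Suc i) (Suc n))"
    by (subst sum.atMost_Suc_shift) simp
  also have "\<dots> = (\<Sum>i\<le>n. scalar (1 / fact i) * fps_nth (fps_deriv S * S ^ i) n)"
    unfolding sum_distrib_left trm ..
  also have "\<dots> = (\<Sum>i\<le>n. \<Sum>k\<le>n. fps_nth (fps_deriv S) k * (scalar (1 / fact i) * fps_nth (S ^ i) (n - k)))"
    by (simp add: fps_mult_nth sum_distrib_left atLeast0AtMost mult.left_commute)
  also have "\<dots> = (\<Sum>k\<le>n. \<Sum>i\<le>n. fps_nth (fps_deriv S) k * (scalar (1 / fact i) * fps_nth (S ^ i) (n - k)))"
    by (rule sum.swap)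
  also have "\<dots> = (\<Sum>k\<le>n. fps_nth (fps_deriv S) k * fps_nth (formal_exp S) (n - k))"
  proof (rule sum.cong[OF refl])
    fix k assume "k \<in> {..n}"
    \<comment> \<open>Powers above \<open>n - k\<close> contribute nothing in degree
      \<open>n - k\<close>, so the common cut-off \<open>n\<close>, needed for exchanging the sums,
      can be lowered to the one of the composition.\<close>
    have "(\<Sum>i\<le>n. scalar (1 / fact i) * fps_nth (S ^ i) (n - k)) = (\<Sum>i\<le>n - k. scalar (1 / fact i) * fps_nth (S ^ i) (n - k))"
      by (rule sum.mono_neutral_right) (auto simp: pow)
    then show "(\<Sum>i\<le>n. fps_nth (fps_deriv S) k * (scalar (1 / fact i) * fps_nth (S ^ i) (n - k))) =
        fps_nth (fps_deriv S) k * fps_nth (formal_exp S) (n - k)"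
      by (simp add: formal_exp_def fps_compose_nth atLeast0AtMost flip: sum_distrib_left)
  qed
  also have "\<dots> = fps_nth (fps_deriv S * formal_exp S) n"
    by (simp add: fps_mult_nth atLeast0AtMost)
  finally show "fps_nth (fps_deriv (formal_exp S)) n = fps_nth (fps_deriv S * formal_exp S) n" .
qed

text \<open>The differential equation determines the coefficient of degree \<open>m + 1\<close> from
  those of degree at most \<open>m\<close>, once the factor \<open>m + 1\<close> is
  cancelled.\<close>

lemma formal_exp_unique:
  assumes A0: "fps_nth A 0 = 1" and S0: "fps_nth S 0 = 0" and A: "fps_deriv A = fps_deriv S * A"
  shows "A = formal_exp S"
proof (rule fps_ext)
  fix n show "fps_nth A n = fps_nth (formal_exp S) n"
  proof (induction n rule: less_induct)
    case (less n)
    show ?case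
    proof (cases n)
      case 0
      then show ?thesis by (simp add: A0 formal_exp_def)
    next
      case (Suc m)
      have "of_nat (Suc m) * fps_nth A (Suc m) = fps_nth (fps_deriv S * A) m"
        unfolding A[symmetric] by simp
      also have "\<dots> = fps_nth (fps_deriv S * formal_exp S) m"
        unfolding fps_mult_nth by (intro sum.cong refl arg_cong2[where f = "(*)"] less) (auto simp: Suc)
      also have "\<dots> = of_nat (Suc m) * fps_nth (formal_exp S) (Suc m)"
        unfolding formal_exp_deriv[OF S0, symmetric] by simp
      finally show ?thesis unfolding Suc by (rule of_nat_fls_cancel)
    qed
  qed
qed

text \<open>The case \<open>m = 2\<close> with \<open>Q d = (-1)\<^sup>d \<hbar>\<^sup>-\<^sup>d\<close> is the one needed for \<open>J\<close>.\<close>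

lemma exponential_formula:
  fixes a c Q :: "nat \<Rightarrow> 'v mpoly fls"
  assumes m: "m > 0" and Q: "Q 0 = 1" "\<And>i j. Q (i + j) = Q i * Q j" and a0: "a 0 = 1"
    and rec: "\<And>n. a (Suc n) = (\<Sum>k\<le>n. of_nat (n choose k) * (c (Suc k) * a (n - k)))"
    and A: "\<And>n. fps_nth A n = (if m dvd n then Q (n div m) * (scalar (1 / fact (n div m)) * a (n div m)) else 0)"
    and S: "\<And>n. fps_nth S n = (if m dvd n \<and> n \<noteq> 0 then Q (n div m) * (scalar (1 / fact (n div m)) * c (n div m)) else 0)"
  shows "A = formal_exp S"
proof (rule formal_exp_unique)
  show "fps_nth A 0 = 1" by (simp add: A Q a0)
  show S0: "fps_nth S 0 = 0" by (simp add: S)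
  \<comment> \<open>This is the equation for z d/dz in place of the derivative. That operator
    preserves degrees, so both sides live on multiples of \<open>m\<close>.\<close>
  have "of_nat n * fps_nth A n = (\<Sum>k\<le>n. of_nat k * fps_nth S k * fps_nth A (n - k))" for n
  proof (cases "m dvd n")
    case False
    then have "of_nat k * fps_nth S k * fps_nth A (n - k) = 0" if "k \<le> n" for k
      using that dvd_diffD[of m n k] by (auto simp: A S)
    then show ?thesis using False by (simp add: A)
  next
    case True
    then obtain d where n: "n = m * d" by blast
    show ?thesis
    proof (cases d)
      case 0
      then show ?thesis by (simp add: n)
    next
      case (Suc e)
      have "(\<Sum>k\<le>n. of_nat k * fps_nth S k * fps_nth A (n - k)) =
          (\<Sum>k\<in>(*) m ` {..d}. of_nat k * fps_nth S k * fps_nth A (n - k))"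
      proof (rule sum.mono_neutral_right)
        show "\<forall>k\<in>{..n} - (*) m ` {..d}. of_nat k * fps_nth S k * fps_nth A (n - k) = 0"
        proof
          fix k assume k: "k \<in> {..n} - (*) m ` {..d}"
          have "\<not> m dvd k"
          proof
            assume "m dvd k"
            then obtain j where "k = m * j" by blast
            then show False using k m by (auto simp: n)
          qed
          then show "of_nat k * fps_nth S k * fps_nth A (n - k) = 0" by (simp add: S)
        qed
      qed (auto simp: n)
      also have "\<dots> = (\<Sum>j\<le>d. of_nat (m * j) * fps_nth S (m * j) * fps_nth A (m * (d - j)))"
        using m by (subst sum.reindex) (auto simp: inj_on_def n right_diff_distrib')
      also have "\<dots> = (\<Sum>i\<le>e. of_nat (m * Suc i) * fps_nth S (m * Suc i) * fps_nth A (m * (e - i)))"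
        unfolding Suc by (subst sum.atMost_Suc_shift) simp
      also have "\<dots> = (\<Sum>i\<le>e. of_nat m * Q d * scalar (1 / fact e) * (of_nat (e choose i) * (c (Suc i) * a (e - i))))"
      proof (rule sum.cong[OF refl])
        fix i assume i: "i \<in> {..e}"
        \<comment> \<open>Multiplicativity lets \<open>Q d\<close> leave the convolution. The factor
          \<open>Suc i\<close> from the derivative turns the reciprocal factorials into a binomial
          coefficient over \<open>fact e\<close>.\<close>
        have QQ: "Q d = Q (Suc i) * Q (e - i)" using i Q(2)[of "Suc i" "e - i"] by (simp add: Suc)
        have "of_nat (Suc i) * (1 / fact (Suc i)) * (1 / fact (e - i)) = 1 / fact e * (of_nat (e choose i) :: complex)"
          using i by (simp add: binomial_fact divide_simps del: of_nat_Suc)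
        then have ss: "of_nat (Suc i) * scalar (1 / fact (Suc i)) * scalar (1 / fact (e - i)) = scalar (1 / fact e) * of_nat (e choose i)"
          unfolding scalar_of_nat[symmetric] scalar_mult by (simp only:)
        have "of_nat (m * Suc i) * fps_nth S (m * Suc i) * fps_nth A (m * (e - i)) =
          of_nat m * of_nat (Suc i) * (Q (Suc i) * (scalar (1 / fact (Suc i)) * c (Suc i))) * (Q (e - i) * (scalar (1 / fact (e - i)) * a (e - i)))"
          using m by (simp add: A S del: of_nat_Suc fact_Suc mult_Suc_right)
        also have "\<dots> = of_nat m * (Q (Suc i) * Q (e - i)) *
            (of_nat (Suc i) * scalar (1 / fact (Suc i)) * scalar (1 / fact (e - i))) * (c (Suc i) * a (e - i))"
          by (simp only: mult_ac)
        also have "\<dots> = of_nat m * Q d * scalar (1 / fact e) * (of_nat (e choose i) * (c (Suc i) * a (e - i)))"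
          unfolding ss QQ by (simp only: mult_ac)
        finally show "of_nat (m * Suc i) * fps_nth S (m * Suc i) * fps_nth A (m * (e - i)) = \<dots>" .
      qed
      also have "\<dots> = of_nat m * Q d * scalar (1 / fact e) * a d"
        unfolding Suc rec sum_distrib_left ..
      also have "\<dots> = of_nat n * fps_nth A n"
      proof -
        have "of_nat d * scalar (1 / fact d) = scalar (1 / fact e)"
          unfolding scalar_of_nat[symmetric] scalar_mult Suc by (simp add: divide_simps del: of_nat_Suc)
        then show ?thesis using m by (simp add: A n mult_ac flip: \<open>of_nat d * scalar (1 / fact d) = scalar (1 / fact e)\<close>)
      qed
      finally show ?thesis ..
    qed
  qed
  then have rec': "of_nat (Suc n) * fps_nth A (Suc n) = (\<Sum>k\<le>Suc n. of_nat k * fps_nth S k * fps_nth A (Suc n - k))" for n .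
  show "fps_deriv A = fps_deriv S * A"
  proof (rule fps_ext)
    fix n
    have "fps_nth (fps_deriv A) n = (\<Sum>k\<le>Suc n. of_nat k * fps_nth S k * fps_nth A (Suc n - k))"
      using rec'[of n] by (simp only: fps_deriv_nth Suc_eq_plus1)
    also have "\<dots> = (\<Sum>k\<le>n. of_nat (Suc k) * fps_nth S (Suc k) * fps_nth A (n - k))"
      by (subst sum.atMost_Suc_shift) simp
    also have "\<dots> = fps_nth (fps_deriv S * A) n"
      by (simp add: fps_mult_nth atLeast0AtMost)
    finally show "fps_nth (fps_deriv A) n = fps_nth (fps_deriv S * A) n" .
  qed
qed

section \<open>Summation over the genus\<close>

text \<open>The hbar-adic convergence of partial sums in terms of coefficients. Here
  \<open>N\<close> is an integer and \<open>k\<close> includes all negative exponents, because the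
  distance depends on the lowest exponent at which two series differ.\<close>

definition fls_converges :: "(nat \<Rightarrow> 'a::comm_ring_1 fls) \<Rightarrow> 'a fls \<Rightarrow> bool" where
  "fls_converges f L \<longleftrightarrow> (\<forall>N. \<forall>\<^sub>F n in sequentially. \<forall>k<N. fls_nth (\<Sum>g<n. f g) k = fls_nth L k)"

lemma fls_converges_sums:
  assumes "fls_converges f L"
  shows "f sums L"
  unfolding sums_def
proof (rule metric_LIMSEQ_I)
  fix e :: real assume "0 < e"
  then obtain N where N: "inverse (2 ^ N) < e"
    using real_arch_pow_inv[of e "1/2"] by (auto simp: power_one_over inverse_eq_divide)
  obtain m where m: "\<And>n k. n \<ge> m \<Longrightarrow> k < int N \<Longrightarrow> fls_nth (\<Sum>g<n. f g) k = fls_nth L k"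
    using assms unfolding fls_converges_def eventually_sequentially by metis
  have "dist (\<Sum>g<n. f g) L < e" if "n \<ge> m" for n
  proof (cases "(\<Sum>g<n. f g) = L")
    case False
    then have deg: "int N \<le> fls_subdegree ((\<Sum>g<n. f g) - L)"
      using m[OF that] by (intro fls_subdegree_geI) auto
    then have "dist (\<Sum>g<n. f g) L = inverse (2 ^ nat (fls_subdegree ((\<Sum>g<n. f g) - L)))"
      using False by (simp add: dist_fls_def)
    also have "\<dots> \<le> inverse (2 ^ N)"
      using deg by (intro le_imp_inverse_le power_increasing) auto
    finally show ?thesis using N by simp
  qed (use \<open>0 < e\<close> in simp)
  then show "\<exists>m. \<forall>n\<ge>m. dist (\<Sum>g<n. f g) L < e" by blast
qed

lemma fls_converges_const_mult:
  assumes "fls_converges f L"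
  shows "fls_converges (\<lambda>g. fls_const c * f g) (fls_const c * L)"
  unfolding fls_converges_def
proof
  fix N
  have "\<forall>\<^sub>F n in sequentially. \<forall>k<N. fls_nth (\<Sum>g<n. f g) k = fls_nth L k"
    using assms by (simp add: fls_converges_def)
  then show "\<forall>\<^sub>F n in sequentially. \<forall>k<N. fls_nth (\<Sum>g<n. fls_const c * f g) k = fls_nth (fls_const c * L) k"
    by (rule eventually_mono) (simp flip: sum_distrib_left)
qed

lemma hbar_pow_nth: "fls_nth (hbar_pow i * f) k = fls_nth f (k - i)"
  by (simp add: hbar_pow_def fls_X_intpow_times_conv_shift)

lemma hbar_pow_nth': "fls_nth (hbar_pow i) k = (if k = i then 1 else 0)"
  using hbar_pow_nth[of i 1 k] by simp

lemma hbar_pow_add: "hbar_pow (i + j) = hbar_pow i * hbar_pow j"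
  by (simp add: hbar_pow_def fls_X_intpow_times_fls_X_intpow)

lemma fls_converges_hbar_mult:
  assumes "fls_converges f L"
  shows "fls_converges (\<lambda>g. hbar_pow i * f g) (hbar_pow i * L)"
  unfolding fls_converges_def
proof
  fix N
  have "\<forall>\<^sub>F n in sequentially. \<forall>k<N - i. fls_nth (\<Sum>g<n. f g) k = fls_nth L k"
    using assms by (simp add: fls_converges_def)
  then show "\<forall>\<^sub>F n in sequentially. \<forall>k<N. fls_nth (\<Sum>g<n. hbar_pow i * f g) k = fls_nth (hbar_pow i * L) k"
    by (rule eventually_mono) (simp add: hbar_pow_nth flip: sum_distrib_left)
qed

lemma fls_converges_sum:
  assumes "finite X" "\<And>x. x \<in> X \<Longrightarrow> fls_converges (f x) (L x)"
  shows "fls_converges (\<lambda>g. \<Sum>x\<in>X. f x g) (\<Sum>x\<in>X. L x)"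
  unfolding fls_converges_def
proof
  fix N
  have "\<forall>\<^sub>F n in sequentially. \<forall>x\<in>X. \<forall>k<N. fls_nth (\<Sum>g<n. f x g) k = fls_nth (L x) k"
    using assms by (intro eventually_ball_finite) (auto simp: fls_converges_def)
  then show "\<forall>\<^sub>F n in sequentially. \<forall>k<N. fls_nth (\<Sum>g<n. \<Sum>x\<in>X. f x g) k = fls_nth (\<Sum>x\<in>X. L x) k"
    by (rule eventually_mono) (simp add: sum.swap[of _ X] fls_nth_sum[of _ X])
qed

text \<open>Different genera give different powers of hbar, and by Riemann-Hurwitz no other power
  carries a nonzero Hurwitz number; the terms merely list the coefficients of the limit.\<close>

lemma genus_hurwitz_converges:
  "fls_converges (\<lambda>g. hbar_pow (2 * int g - 2 + int (size \<alpha>) + int (size \<beta>)) * of_nat (genus_hurwitz d g \<alpha> \<beta>))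
     (fps_to_fls (Abs_fps (\<lambda>r. of_nat (hurwitz_number d r \<alpha> \<beta>))) :: 'v mpoly fls)"
  unfolding fls_converges_def
proof
  fix N
  let ?r = "\<lambda>g. 2 * int g - 2 + int (size \<alpha>) + int (size \<beta>)"
  let ?f = "\<lambda>g. hbar_pow (?r g) * of_nat (genus_hurwitz d g \<alpha> \<beta>) :: 'v mpoly fls"
  let ?L = "fps_to_fls (Abs_fps (\<lambda>r. of_nat (hurwitz_number d r \<alpha> \<beta>))) :: 'v mpoly fls"
  \<comment> \<open>At a negative exponent both sides vanish: \<open>genus_hurwitz\<close> is zero
    by convention and the limit has no negative powers.\<close>
  have f: "fls_nth (?f g) k = (if k = ?r g then fls_nth ?L k else 0)" for g k
    by (auto simp: hbar_pow_nth' genus_hurwitz_def Let_def)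
  \<comment> \<open>A genus contributing in degree \<open>k\<close> satisfies
    \<open>2 * int g - 2 \<le> k\<close>, hence lies below the crude bound
    \<open>nat N + 2\<close>.\<close>
  have "fls_nth (\<Sum>g<n. ?f g) k = fls_nth ?L k" if n: "n \<ge> nat N + 2" and k: "k < N" for n k
  proof (cases "\<exists>g. k = ?r g")
    case True
    then obtain g where g: "k = ?r g" by blast
    have "g < n" using g k n by linarith
    have "(\<Sum>h<n. fls_nth (?f h) k) = (\<Sum>h<n. if h = g then fls_nth ?L k else 0)"
      unfolding f by (rule sum.cong) (auto simp: g)
    then show ?thesis using \<open>g < n\<close> by (simp add: fls_nth_sum)
  next
    case False
    then have "fls_nth (\<Sum>g<n. ?f g) k = 0"
      unfolding fls_nth_sum f by (intro sum.neutral) auto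
    moreover have "fls_nth ?L k = 0"
    proof (cases "k < 0")
      case nonneg: False
      then have "hurwitz_number d (nat k) \<alpha> \<beta> = 0"
        using False hurwitz_number_genus[of d "nat k" \<alpha> \<beta>] by auto
      then show ?thesis using nonneg by simp
    qed simp
    ultimately show ?thesis by simp
  qed
  then show "\<forall>\<^sub>F n in sequentially. \<forall>k<N. fls_nth (\<Sum>g<n. ?f g) k = fls_nth ?L k"
    unfolding eventually_sequentially by blast
qed

lemma sum_partitions_to_fls:
  fixes g :: "nat multiset \<Rightarrow> nat multiset \<Rightarrow> 'v mpoly"
  shows "(\<Sum>\<alpha>\<in>partitions d. \<Sum>\<beta>\<in>partitions d.
      fls_const (g \<alpha> \<beta>) * fps_to_fls (Abs_fps (\<lambda>r. of_nat (walk_number d r \<alpha> \<beta>)))) =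
      fps_to_fls (walk_series g {1..d})"
    and "(\<Sum>\<alpha>\<in>partitions d. \<Sum>\<beta>\<in>partitions d.
      fls_const (g \<alpha> \<beta>) * fps_to_fls (Abs_fps (\<lambda>r. of_nat (hurwitz_number d r \<alpha> \<beta>)))) =
      fps_to_fls (connected_series g {1..d})"
  by (rule fls_eqI; simp add: fls_nth_sum series_eq_sum_partitions[symmetric] del: One_nat_def)+

text \<open>The prefactor and the powers recording the two lengths combine to the Riemann-Hurwitz
  exponent, which reduces the claim to one pair of partitions at a time.\<close>

lemma genus_sum_converges:
  fixes g :: "nat multiset \<Rightarrow> nat multiset \<Rightarrow> 'v mpoly"
  shows "fls_converges (\<lambda>h. hbar_pow (2 * int h - 2) * (\<Sum>\<alpha>\<in>partitions d. \<Sum>\<beta>\<in>partitions d.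
        hbar_pow (int (size \<alpha>) + int (size \<beta>)) * fls_const (g \<alpha> \<beta>) * of_nat (genus_hurwitz d h \<alpha> \<beta>)))
     (fps_to_fls (connected_series g {1..d}))"
proof -
  have "(\<lambda>h. hbar_pow (2 * int h - 2) * (\<Sum>\<alpha>\<in>partitions d. \<Sum>\<beta>\<in>partitions d.
        hbar_pow (int (size \<alpha>) + int (size \<beta>)) * fls_const (g \<alpha> \<beta>) * of_nat (genus_hurwitz d h \<alpha> \<beta>))) =
    (\<lambda>h. \<Sum>\<alpha>\<in>partitions d. \<Sum>\<beta>\<in>partitions d.
        fls_const (g \<alpha> \<beta>) * (hbar_pow (2 * int h - 2 + int (size \<alpha>) + int (size \<beta>)) * of_nat (genus_hurwitz d h \<alpha> \<beta>)))"
    by (simp only: sum_distrib_left hbar_pow_add mult_ac)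
  then show ?thesis
    unfolding sum_partitions_to_fls(2)[symmetric]
    by (simp only:) (intro fls_converges_sum fls_converges_const_mult genus_hurwitz_converges finite_partitions)
qed

section \<open>The series I and J\<close>

lemma fps_to_fls_sum: "fps_to_fls (\<Sum>x\<in>X. f x) = (\<Sum>x\<in>X. fps_to_fls (f x))"
  by (induction X rule: infinite_finite_induct) simp_all

lemma walk_series_recurrence_fls:
  fixes g :: "nat multiset \<Rightarrow> nat multiset \<Rightarrow> 'v mpoly"
  assumes "multiplicative_weight g"
  shows "fps_to_fls (walk_series g {1..Suc n}) = (\<Sum>k\<le>n. of_nat (n choose k) *
    (fps_to_fls (connected_series g {1..Suc k}) * fps_to_fls (walk_series g {1..n - k})))"
  unfolding walk_series_recurrence[OF assms] fps_to_fls_sum fls_times_fps_to_fls fps_to_fls_of_nat ..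

lemma formal_sum_of_converges:
  assumes "\<And>n. fls_converges (\<lambda>g. fps_nth (f g) n) (L n)"
  shows "formal_summable f" and "fps_nth (formal_suminf f) n = L n"
  using assms[THEN fls_converges_sums]
  by (auto simp: formal_summable_def formal_suminf_def sums_iff)

lemma fls_converges_0: "fls_converges (\<lambda>_. 0) 0"
  by (simp add: fls_converges_def)

definition weight_I :: "nat multiset \<Rightarrow> nat multiset \<Rightarrow> (nat + nat) mpoly" where
  "weight_I \<alpha> \<beta> = p_A \<alpha> * p_B \<beta>"

text \<open>Testing that all parts are one singles out \<open>(1^d)\<close> without mentioning
  \<open>d\<close>; the test holds for a sum exactly if it holds for both summands, which keeps the
  weight multiplicative.\<close>

definition weight_J :: "nat multiset \<Rightarrow> nat multiset \<Rightarrow> nat mpoly" where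
  "weight_J \<alpha> \<beta> = (if \<forall>k\<in>#\<alpha>. k = 1 then p_C \<beta> else 0)"

lemma multiplicative_weight_I: "multiplicative_weight weight_I"
  by (simp add: multiplicative_weight_def weight_I_def p_A_def p_B_def mult_ac)

lemma multiplicative_weight_J: "multiplicative_weight weight_J"
  by (auto simp: multiplicative_weight_def weight_J_def p_C_def)

lemma F_genus_converges:
  "fls_converges (\<lambda>h. fps_nth (genus_terms F_genus h) d)
     (if d = 0 then 0 else scalar (1 / fact d) * fps_to_fls (connected_series weight_I {1..d}))"
proof (cases "d = 0")
  case True
  then show ?thesis by (simp add: genus_terms_def F_genus_def fls_converges_0)
next
  case False
  have "fls_converges (\<lambda>h. scalar (1 / fact d) * (hbar_pow (2 * int h - 2) * (\<Sum>\<alpha>\<in>partitions d. \<Sum>\<beta>\<in>partitions d.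
        hbar_pow (int (size \<alpha>) + int (size \<beta>)) * fls_const (weight_I \<alpha> \<beta>) * of_nat (genus_hurwitz d h \<alpha> \<beta>))))
     (scalar (1 / fact d) * fps_to_fls (connected_series weight_I {1..d}))"
    unfolding scalar_def by (intro fls_converges_const_mult genus_sum_converges)
  then show ?thesis
    using False by (simp add: genus_terms_def F_genus_def weight_I_def mult.left_commute[of "hbar_pow _" "scalar _"])
qed

lemma I_series_nth:
  "fps_nth I_series d = scalar (1 / fact d) * fps_to_fls (walk_series weight_I {1..d})"
proof (cases "d = 0")
  case True
  then show ?thesis using walk_series_empty[OF multiplicative_weight_I] by (simp add: I_series_def)
next
  case False
  then show ?thesis
    unfolding sum_partitions_to_fls(1)[symmetric] by (simp add: I_series_def weight_I_def)
qed

lemma I_series_eq_exp: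
  "formal_summable (genus_terms F_genus)"
  "I_series = formal_exp (formal_suminf (genus_terms F_genus))"
proof -
  show "formal_summable (genus_terms F_genus)"
    by (rule formal_sum_of_converges(1)) (rule F_genus_converges)
  show "I_series = formal_exp (formal_suminf (genus_terms F_genus))"
  proof (rule exponential_formula[where m = 1 and Q = "\<lambda>_. 1"
        and a = "\<lambda>d. fps_to_fls (walk_series weight_I {1..d})"
        and c = "\<lambda>d. fps_to_fls (connected_series weight_I {1..d})"])
    show "fps_to_fls (walk_series weight_I {1..0::nat}) = 1"
      unfolding walk_series_empty[OF multiplicative_weight_I] by simp
  qed (simp_all add: walk_series_recurrence_fls[OF multiplicative_weight_I] I_series_nth
      formal_sum_of_converges(2)[OF F_genus_converges] del: One_nat_def)
qed

lemma partitions_ones_iff: "\<alpha> \<in> partitions d \<and> (\<forall>k\<in>#\<alpha>. k = 1) \<longleftrightarrow> \<alpha> = replicate_mset d 1"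
proof
  assume a: "\<alpha> \<in> partitions d \<and> (\<forall>k\<in>#\<alpha>. k = 1)"
  then have "\<alpha> = replicate_mset (size \<alpha>) 1" by (intro set_mset_subset_singletonD) auto
  moreover have "sum_mset (replicate_mset (size \<alpha>) 1) = size \<alpha>" by simp
  moreover have "sum_mset \<alpha> = d" using a by (simp add: partitions_def)
  ultimately show "\<alpha> = replicate_mset d 1" by metis
qed (auto simp: partitions_def split: if_splits)

text \<open>The hypothesis fits summands that contain \<open>weight_J \<alpha>\<close> as a factor
  inside a further sum over \<open>\<beta>\<close>: for any partition other than
  \<open>(1^d)\<close> this weight vanishes identically.\<close>

lemma sum_weight_J:
  assumes "\<And>\<alpha>. weight_J \<alpha> = (\<lambda>_. 0) \<Longrightarrow> f \<alpha> = 0"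
  shows "(\<Sum>\<alpha>\<in>partitions d. f \<alpha>) = f (replicate_mset d 1)"
proof -
  have "f \<alpha> = 0" if "\<alpha> \<in> partitions d - {replicate_mset d 1}" for \<alpha>
    using that partitions_ones_iff[of \<alpha> d] by (intro assms ext) (auto simp: weight_J_def)
  moreover have "replicate_mset d 1 \<in> partitions d" using partitions_ones_iff by blast
  ultimately have "sum f (partitions d) = sum f {replicate_mset d 1}"
    by (intro sum.mono_neutral_right finite_partitions) auto
  then show ?thesis by simp
qed

lemma weight_J_ones: "weight_J (replicate_mset d 1) \<beta> = p_C \<beta>"
  by (simp add: weight_J_def)

text \<open>The factor by which the coefficient of J in degree \<open>2 * d\<close> differs from
  that of a plain exponential generating series. It is multiplicative in \<open>d\<close> and
  therefore compatible with the exponential.\<close>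

definition twist :: "nat \<Rightarrow> 'v mpoly fls" where
  "twist d = scalar ((-1) ^ d) * hbar_pow (- int d)"

lemma twist_add: "twist (i + j) = twist i * twist j"
proof -
  have "twist (i + j) = (scalar ((-1) ^ i) * scalar ((-1) ^ j)) * (hbar_pow (- int i) * hbar_pow (- int j))"
    unfolding twist_def scalar_mult hbar_pow_add[symmetric] by (simp add: power_add)
  then show ?thesis by (simp only: twist_def mult_ac)
qed

lemma twist_scalar:
  "scalar ((-1) ^ d / fact d) * hbar_pow (- int d) = (twist d * scalar (1 / fact d) :: 'v mpoly fls)"
proof -
  have "scalar ((-1) ^ d / fact d) * hbar_pow (- int d) =
      (scalar ((-1) ^ d) * scalar (1 / fact d)) * (hbar_pow (- int d) :: 'v mpoly fls)"
    unfolding scalar_mult by simp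
  also have "\<dots> = twist d * scalar (1 / fact d)" by (simp only: twist_def mult_ac)
  finally show ?thesis .
qed

lemma G_genus_converges:
  "fls_converges (\<lambda>h. fps_nth (genus_terms G_genus h) n)
     (if 2 dvd n \<and> n \<noteq> 0 then twist (n div 2) * (scalar (1 / fact (n div 2)) *
        fps_to_fls (connected_series weight_J {1..n div 2})) else 0)"
proof (cases "even n \<and> n \<noteq> 0")
  case False
  then have "fps_nth (genus_terms G_genus h) n = 0" for h by (auto simp: genus_terms_def G_genus_def)
  then show ?thesis using False by (auto simp: fls_converges_0)
next
  case True
  define d where "d = n div 2"
  let ?\<Sigma> = "\<lambda>h. \<Sum>\<alpha>\<in>partitions d. \<Sum>\<beta>\<in>partitions d.
        hbar_pow (int (size \<alpha>) + int (size \<beta>)) * fls_const (weight_J \<alpha> \<beta>) * of_nat (genus_hurwitz d h \<alpha> \<beta>)"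
  let ?\<Gamma> = "\<lambda>h. \<Sum>\<beta>\<in>partitions d.
        hbar_pow (int (size \<beta>)) * fls_const (p_C \<beta>) * of_nat (genus_hurwitz d h (replicate_mset d 1) \<beta>)"
  \<comment> \<open>The cycle type \<open>(1^d)\<close> has \<open>d\<close> parts, so the general
    genus sum carries a factor hbar to the power \<open>d\<close> that is absent from
    \<open>G_genus\<close>; the negative power in \<open>twist\<close> will cancel it.\<close>
  have \<Sigma>: "?\<Sigma> h = hbar_pow (int d) * ?\<Gamma> h" for h
  proof -
    have "?\<Sigma> h = (\<Sum>\<beta>\<in>partitions d. hbar_pow (int (size (replicate_mset d (1::nat))) + int (size \<beta>)) *
        fls_const (weight_J (replicate_mset d 1) \<beta>) * of_nat (genus_hurwitz d h (replicate_mset d 1) \<beta>))"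
      by (rule sum_weight_J) simp
    then show ?thesis
      unfolding weight_J_ones size_replicate_mset hbar_pow_add sum_distrib_left mult.assoc .
  qed
  have inv: "hbar_pow (- int d) * hbar_pow (int d) = 1"
    unfolding hbar_pow_add[symmetric] by (simp add: hbar_pow_def)
  have nth: "fps_nth (genus_terms G_genus h) n = twist d * (scalar (1 / fact d) * (hbar_pow (2 * int h - 2) * ?\<Sigma> h))" for h
  proof -
    have "fps_nth (genus_terms G_genus h) n = hbar_pow (2 * int h - 2) * (scalar ((-1) ^ d / fact d) * ?\<Gamma> h)"
      using True by (simp add: genus_terms_def G_genus_def d_def Let_def)
    also have "\<dots> = scalar ((-1) ^ d / fact d) * (hbar_pow (- int d) * hbar_pow (int d)) * (hbar_pow (2 * int h - 2) * ?\<Gamma> h)"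
      unfolding inv mult_1_right by (rule mult.left_commute)
    also have "\<dots> = (scalar ((-1) ^ d / fact d) * hbar_pow (- int d)) * (hbar_pow (2 * int h - 2) * (hbar_pow (int d) * ?\<Gamma> h))"
      by (simp only: mult_ac)
    finally show ?thesis unfolding twist_scalar \<Sigma> unfolding mult.assoc .
  qed
  have "fls_converges (\<lambda>h. fls_const (Poly_Mapping.single 0 ((-1) ^ d)) * (hbar_pow (- int d) *
        (fls_const (Poly_Mapping.single 0 (1 / fact d)) * (hbar_pow (2 * int h - 2) * ?\<Sigma> h))))
     (fls_const (Poly_Mapping.single 0 ((-1) ^ d)) * (hbar_pow (- int d) *
        (fls_const (Poly_Mapping.single 0 (1 / fact d)) * fps_to_fls (connected_series weight_J {1..d}))))"
    by (intro fls_converges_const_mult fls_converges_hbar_mult genus_sum_converges)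
  then have "fls_converges (\<lambda>h. fps_nth (genus_terms G_genus h) n)
      (twist d * (scalar (1 / fact d) * fps_to_fls (connected_series weight_J {1..d})))"
    unfolding nth twist_def scalar_def[symmetric] mult.assoc .
  then show ?thesis using True by (simp add: d_def)
qed

lemma J_series_nth:
  "fps_nth J_series n = (if 2 dvd n then twist (n div 2) * (scalar (1 / fact (n div 2)) *
     fps_to_fls (walk_series weight_J {1..n div 2})) else 0)"
proof (cases "n = 0")
  case True
  have "twist 0 = (1 :: nat mpoly fls)" by (simp add: twist_def hbar_pow_def)
  then show ?thesis using True walk_series_empty[OF multiplicative_weight_J] by (simp add: J_series_def)
next
  case False
  define d where "d = n div 2"
  have "fps_to_fls (walk_series weight_J {1..d}) = (\<Sum>\<beta>\<in>partitions d. fls_const (weight_J (replicate_mset d 1) \<beta>) *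
      fps_to_fls (Abs_fps (\<lambda>r. of_nat (walk_number d r (replicate_mset d 1) \<beta>))))"
    unfolding sum_partitions_to_fls(1)[symmetric] by (rule sum_weight_J) simp
  then show ?thesis
    using False by (simp add: twist_scalar J_series_def d_def[symmetric] weight_J_ones mult.assoc[symmetric] del: One_nat_def)
qed

lemma J_series_eq_exp:
  "formal_summable (genus_terms G_genus)"
  "J_series = formal_exp (formal_suminf (genus_terms G_genus))"
proof -
  show "formal_summable (genus_terms G_genus)"
    by (rule formal_sum_of_converges(1)) (rule G_genus_converges)
  show "J_series = formal_exp (formal_suminf (genus_terms G_genus))"
  proof (rule exponential_formula[where m = 2 and Q = twist
        and a = "\<lambda>d. fps_to_fls (walk_series weight_J {1..d})"
        and c = "\<lambda>d. fps_to_fls (connected_series weight_J {1..d})"])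
    show "fps_to_fls (walk_series weight_J {1..0::nat}) = 1"
      unfolding walk_series_empty[OF multiplicative_weight_J] by simp
    show "twist 0 = (1 :: nat mpoly fls)" by (simp add: twist_def hbar_pow_def)
    show "twist (i + j) = (twist i * twist j :: nat mpoly fls)" for i j by (rule twist_add)
  qed (simp_all add: walk_series_recurrence_fls[OF multiplicative_weight_J] J_series_nth
      formal_sum_of_converges(2)[OF G_genus_converges] del: One_nat_def)
qed

theorem theorem3p3:
  shows "formal_summable (genus_terms F_genus) \<and>
         I_series = formal_exp (formal_suminf (genus_terms F_genus)) \<and>
         formal_summable (genus_terms G_genus) \<and>
         J_series = formal_exp (formal_suminf (genus_terms G_genus))"
  by (intro conjI I_series_eq_exp J_series_eq_exp)

end
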